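(* Let $N\ge 2$ and consider an $N$-player game with cost functions $f_i:\mathbb{R}^N\to\mathbb{R}$, $i\in\mathcal{N}=\{1,\dots,N\}$, where the action $x_i\in\mathbb{R}$ of player $i$ is governed by $$\dot x_i=b_{i1}v_i+\phi_{i1}(x_i)\theta_{i1},\qquad \dot v_i=b_{i2}u_i+\phi_{i2}(x_i,v_i)\theta_{i2},\quad i\in\mathcal{N},$$ with $v_i\in\mathbb{R}$ a state, $\theta_{i1},\theta_{i2},b_{i1},b_{i2}$ unknown constants, $b_{i1}\ne0$, $b_{i2}\neq 0$, and $\phi_{i1},\phi_{i2}$ smooth functions. Suppose: (A1) each $f_i$ is sufficiently smooth and $\frac{\partial f_i}{\partial x_i}$ is globally Lipschitz with constant $l_i$; (A2) there is a constant $m>0$ with $(\mathbf{x}-\mathbf{z})^T(\mathcal{P}(\mathbf{x})-\mathcal{P}(\mathbf{z}))\ge m\|\mathbf{x}-\mathbf{z}\|^2$ for all $\mathbf{x},\mathbf{z}\in\mathbb{R}^N$, where $\mathcal{P}(\mathbf{x})=\left[\frac{\partial f_1(\mathbf{x})}{\partial x_1},\dots,\frac{\partial f_N(\mathbf{x})}{\partial x_N}\right]^T$; (A3) the players have an undirected and connected communication graph with adjacency matrix $[a_{ij}]$; (A5) for each $i$, $\phi_{i1}(x_i)$ and $\frac{\partial\phi_{i1}(x_i)}{\partial x_i}$ are bounded provided that $x_i$ is bounded, and $\phi_{i2}(x_i,v_i)$ is bounded if $x_i$ and $v_i$ are bounded. Let $N_0(k)=k^2\sin(k)$ and let the control input be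 defined by $$\dot y_i=-\nabla_i f_i(\mathbf{z}_i),\qquad \dot z_{ij}=-\delta_{ij}\Big(\sum_{k=1}^N a_{ik}(z_{ij}-z_{kj})+a_{ij}(z_{ij}-y_j)\Big),\quad i,j\in\mathcal{N},$$ $$\alpha_i=N_0(k_{i1})\big(x_i-y_i+\phi_{i1}(x_i)\hat\theta_{i1}\big),\quad \dot k_{i1}=(x_i-y_i)\big(x_i-y_i+\phi_{i1}(x_i)\hat\theta_{i1}\big),\quad \dot{\hat\theta}_{i1}=\phi_{i1}(x_i)(x_i-y_i),$$ $$\beta_i=v_i-\alpha_i,\qquad u_i=N_0(k_{i2})\big(\beta_i+\phi_{i2}\bar\theta_{i2}+\Psi_{i1}\bar\theta_{i1}+\Psi_{i2}+\Psi_{i3}\bar b_{i1}\big),$$ $$\dot k_{i2}=\beta_i\big(\beta_i+\phi_{i2}\bar\theta_{i2}+\Psi_{i1}\bar\theta_{i1}+\Psi_{i2}+\Psi_{i3}\bar b_{i1}\big),\quad \dot{\bar\theta}_{i2}=\beta_i\phi_{i2},\quad \dot{\bar\theta}_{i1}=\beta_i\Psi_{i1},\quad \dot{\bar b}_{i1}=\beta_i\Psi_{i3},$$ where $\mathbf{z}_i=[z_{i1},\dots,z_{iN}]^T$, $\delta_{ij}=\delta\bar\delta_{ij}$, $\delta>0$ and $\bar\delta_{ij}>0$ are fixed constants, $\phi_{i2}=\phi_{i2}(x_i,v_i)$, and $$\Psi_{i1}=-N_0(k_{i1})\Big(\phi_{i1}(x_i)+\tfrac{\partial\phi_{i1}(x_i)}{\partial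 x_i}\hat\theta_{i1}\phi_{i1}(x_i)\Big),$$ $$\Psi_{i2}=-\big(2k_{i1}\sin(k_{i1})+k_{i1}^2\cos(k_{i1})\big)(x_i-y_i)\big(x_i-y_i+\phi_{i1}(x_i)\hat\theta_{i1}\big)^2-N_0(k_{i1})\big(-\dot y_i+\phi_{i1}^2(x_i)(x_i-y_i)\big),$$ $$\Psi_{i3}=-N_0(k_{i1})\Big(\tfrac{\partial\phi_{i1}(x_i)}{\partial x_i}\hat\theta_{i1}+1\Big)v_i.$$ Then there exists a positive constant $\delta^*$ such that for each $\delta\in(\delta^*,\infty)$ (and every initial condition of the closed-loop system), $$\lim_{t\to\infty}\|\mathbf{x}(t)-\mathbf{x}^*\|=0,$$ where $\mathbf{x}=[x_1,\dots,x_N]^T$ and $\mathbf{x}^*$ is the Nash equilibrium of the game, and the other variables ($v_i,y_i,z_{ij},k_{i1},\hat\theta_{i1},k_{i2},\bar\theta_{i1},\bar\theta_{i2},\bar b_{i1}$ for all $i,j\in\mathcal{N}$) stay bounded.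
   Context: Notation: $\nabla_i f_i(\mathbf{z}_i)=\frac{\partial f_i(\mathbf{x})}{\partial x_i}\big|_{\mathbf{x}=\mathbf{z}_i}$; all controller variables are real-valued. In $\Psi_{i2}$, $\dot y_i=-\nabla_i f_i(\mathbf{z}_i)$. An action profile $\mathbf{x}^*=(x_i^*,\mathbf{x}_{-i}^* )$ is a Nash equilibrium if for each $i\in\mathcal{N}$, $f_i(x_i^*,\mathbf{x}_{-i}^* )\le f_i(x_i,\mathbf{x}_{-i}^* )$ for all $x_i\in\mathbb{R}$, where $\mathbf{x}_{-i}=[x_1,\dots,x_{i-1},x_{i+1},\dots,x_N]^T$. The signs of the $b_{i1},b_{i2}$ are unknown and need not coincide. Communication graph: node set $\mathcal{N}$, edge set $\mathcal{E}_d$; an edge $(i,j)\in\mathcal{E}_d$ means node $j$ can receive information from node $i$. The adjacency matrix satisfies $a_{ij}>0$ if $(j,i)\in\mathcal{E}_d$, $a_{ij}=0$ otherwise, and $a_{ii}=0$; for an undirected graph $a_{ij}=a_{ji}$. An undirected graph is connected if there is a path between any two distinct nodes. *)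

theory Defs
  imports "HOL-Analysis.Analysis"
begin

text \<open>
  Players are the elements of a finite type \<open>'n\<close>; an action profile is a vector in
  \<open>real ^ 'n\<close>.
\<close>

section \<open>Smoothness\<close>

text \<open>
  \<open>C_k k g\<close>: the function \<open>g\<close> is \<open>k\<close> times continuously differentiable on the whole space.
  The directional derivatives along \<open>Basis\<close> are the partial derivatives (the ordinary
  derivative if the domain is \<open>real\<close>).
\<close>

primrec C_k :: "nat \<Rightarrow> ('a::euclidean_space \<Rightarrow> real) \<Rightarrow> bool" where
  "C_k 0 g \<longleftrightarrow> continuous_on UNIV g"
| "C_k (Suc k) g \<longleftrightarrow> g differentiable_on UNIV \<and>
     (\<forall>b\<in>Basis. C_k k (\<lambda>x. frechet_derivative g (at x) b))"

definition smooth :: "('a::euclidean_space \<Rightarrow> real) \<Rightarrow> bool" where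
  "smooth g \<longleftrightarrow> (\<forall>k. C_k k g)"


section \<open>The game\<close>

definition deviate :: "real ^ 'n \<Rightarrow> 'n \<Rightarrow> real \<Rightarrow> real ^ 'n" where
  "deviate x i r = (\<chi> j. if j = i then r else x $ j)"

definition partial :: "'n \<Rightarrow> (real ^ 'n \<Rightarrow> real) \<Rightarrow> real ^ 'n \<Rightarrow> real" where
  "partial i g x = deriv (\<lambda>r. g (deviate x i r)) (x $ i)"

definition pseudo_gradient :: "('n \<Rightarrow> real ^ 'n \<Rightarrow> real) \<Rightarrow> real ^ 'n \<Rightarrow> real ^ 'n" where
  "pseudo_gradient f x = (\<chi> i. partial i (f i) x)"

definition nash_equilibrium :: "('n \<Rightarrow> real ^ 'n \<Rightarrow> real) \<Rightarrow> real ^ 'n \<Rightarrow> bool" where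
  "nash_equilibrium f x \<longleftrightarrow> (\<forall>i r. f i x \<le> f i (deviate x i r))"


section \<open>The communication graph\<close>

text \<open>An edge \<open>(i, j)\<close> means that \<open>j\<close> receives information from \<open>i\<close>, hence the swapped indices.\<close>

definition adjacency_matrix :: "('n \<times> 'n) set \<Rightarrow> ('n \<Rightarrow> 'n \<Rightarrow> real) \<Rightarrow> bool" where
  "adjacency_matrix E a \<longleftrightarrow>
     (\<forall>i j. ((j, i) \<in> E \<longrightarrow> a i j > 0) \<and> ((j, i) \<notin> E \<longrightarrow> a i j = 0)) \<and> (\<forall>i. a i i = 0)"

definition undirected_graph :: "('n \<times> 'n) set \<Rightarrow> ('n \<Rightarrow> 'n \<Rightarrow> real) \<Rightarrow> bool" where
  "undirected_graph E a \<longleftrightarrow> sym E \<and> (\<forall>i j. a i j = a j i)"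

definition connected_graph :: "('n \<times> 'n) set \<Rightarrow> bool" where
  "connected_graph E \<longleftrightarrow> (\<forall>i j. i \<noteq> j \<longrightarrow> (i, j) \<in> E\<^sup>+)"


section \<open>The closed-loop system\<close>

text \<open>
  Component \<open>i\<close> of each field belongs to player \<open>i\<close>; row \<open>i\<close> of \<open>st_z\<close> is the vector
  \<open>z\<^sub>i\<close> of player \<open>i\<close>'s estimates. The fields \<open>st_th1hat\<close>, \<open>st_th1bar\<close>,
  \<open>st_th2bar\<close>, \<open>st_b1bar\<close> are the parameter estimates written with a hat or a bar on
  \<open>\<theta>\<^sub>1\<close>, \<open>\<theta>\<^sub>1\<close>, \<open>\<theta>\<^sub>2\<close>, \<open>b\<^sub>1\<close>.
\<close>

record ('n::finite) state =
  st_x :: "real ^ 'n"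
  st_v :: "real ^ 'n"
  st_y :: "real ^ 'n"
  st_z :: "real ^ 'n ^ 'n"
  st_k1 :: "real ^ 'n"
  st_th1hat :: "real ^ 'n"
  st_k2 :: "real ^ 'n"
  st_th2bar :: "real ^ 'n"
  st_th1bar :: "real ^ 'n"
  st_b1bar :: "real ^ 'n"

definition N0 :: "real \<Rightarrow> real" where
  "N0 k = k\<^sup>2 * sin k"

definition y_rate :: "('n::finite \<Rightarrow> real ^ 'n \<Rightarrow> real) \<Rightarrow> 'n \<Rightarrow> 'n state \<Rightarrow> real" where
  "y_rate f i s = - partial i (f i) (st_z s $ i)"

text \<open>The factor \<open>x\<^sub>i - y\<^sub>i + \<phi>\<^sub>i\<^sub>1(x\<^sub>i) \<theta>\<^sub>i\<^sub>1\<close> (with \<open>\<theta>\<^sub>i\<^sub>1\<close> replaced by its hat estimate).\<close>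

definition eta1 :: "('n::finite \<Rightarrow> real \<Rightarrow> real) \<Rightarrow> 'n \<Rightarrow> 'n state \<Rightarrow> real" where
  "eta1 \<phi>1 i s = st_x s $ i - st_y s $ i + \<phi>1 i (st_x s $ i) * st_th1hat s $ i"

definition alpha :: "('n::finite \<Rightarrow> real \<Rightarrow> real) \<Rightarrow> 'n \<Rightarrow> 'n state \<Rightarrow> real" where
  "alpha \<phi>1 i s = N0 (st_k1 s $ i) * eta1 \<phi>1 i s"

definition beta :: "('n::finite \<Rightarrow> real \<Rightarrow> real) \<Rightarrow> 'n \<Rightarrow> 'n state \<Rightarrow> real" where
  "beta \<phi>1 i s = st_v s $ i - alpha \<phi>1 i s"

definition Psi1 :: "('n::finite \<Rightarrow> real \<Rightarrow> real) \<Rightarrow> 'n \<Rightarrow> 'n state \<Rightarrow> real" where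
  "Psi1 \<phi>1 i s = - N0 (st_k1 s $ i) *
     (\<phi>1 i (st_x s $ i) + deriv (\<phi>1 i) (st_x s $ i) * st_th1hat s $ i * \<phi>1 i (st_x s $ i))"

definition Psi2 ::
  "('n::finite \<Rightarrow> real ^ 'n \<Rightarrow> real) \<Rightarrow> ('n \<Rightarrow> real \<Rightarrow> real) \<Rightarrow> 'n \<Rightarrow> 'n state \<Rightarrow> real" where
  "Psi2 f \<phi>1 i s =
     - (2 * st_k1 s $ i * sin (st_k1 s $ i) + (st_k1 s $ i)\<^sup>2 * cos (st_k1 s $ i)) *
         (st_x s $ i - st_y s $ i) * (eta1 \<phi>1 i s)\<^sup>2
     - N0 (st_k1 s $ i) *
         (- y_rate f i s + (\<phi>1 i (st_x s $ i))\<^sup>2 * (st_x s $ i - st_y s $ i))"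

definition Psi3 :: "('n::finite \<Rightarrow> real \<Rightarrow> real) \<Rightarrow> 'n \<Rightarrow> 'n state \<Rightarrow> real" where
  "Psi3 \<phi>1 i s = - N0 (st_k1 s $ i) *
     (deriv (\<phi>1 i) (st_x s $ i) * st_th1hat s $ i + 1) * st_v s $ i"

definition eta2 ::
  "('n::finite \<Rightarrow> real ^ 'n \<Rightarrow> real) \<Rightarrow> ('n \<Rightarrow> real \<Rightarrow> real) \<Rightarrow> ('n \<Rightarrow> real \<times> real \<Rightarrow> real) \<Rightarrow>
   'n \<Rightarrow> 'n state \<Rightarrow> real" where
  "eta2 f \<phi>1 \<phi>2 i s =
     beta \<phi>1 i s + \<phi>2 i (st_x s $ i, st_v s $ i) * st_th2bar s $ i
     + Psi1 \<phi>1 i s * st_th1bar s $ i + Psi2 f \<phi>1 i s + Psi3 \<phi>1 i s * st_b1bar s $ i"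

definition control ::
  "('n::finite \<Rightarrow> real ^ 'n \<Rightarrow> real) \<Rightarrow> ('n \<Rightarrow> real \<Rightarrow> real) \<Rightarrow> ('n \<Rightarrow> real \<times> real \<Rightarrow> real) \<Rightarrow>
   'n \<Rightarrow> 'n state \<Rightarrow> real" where
  "control f \<phi>1 \<phi>2 i s = N0 (st_k2 s $ i) * eta2 f \<phi>1 \<phi>2 i s"

text \<open>
  \<open>S\<close> is a solution on the time axis \<open>[0, \<infinity>)\<close>; the derivative at time \<open>0\<close> is one-sided, and
  values of \<open>S\<close> at negative times are irrelevant. The argument \<open>\<delta>\<close> is the matrix of gains
  \<open>\<delta>\<^sub>i\<^sub>j\<close>.
\<close>

definition closed_loop_solution ::
  "('n::finite \<Rightarrow> real ^ 'n \<Rightarrow> real) \<Rightarrow> ('n \<Rightarrow> 'n \<Rightarrow> real) \<Rightarrow>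
   ('n \<Rightarrow> real \<Rightarrow> real) \<Rightarrow> ('n \<Rightarrow> real \<times> real \<Rightarrow> real) \<Rightarrow>
   ('n \<Rightarrow> real) \<Rightarrow> ('n \<Rightarrow> real) \<Rightarrow> ('n \<Rightarrow> real) \<Rightarrow> ('n \<Rightarrow> real) \<Rightarrow>
   ('n \<Rightarrow> 'n \<Rightarrow> real) \<Rightarrow> (real \<Rightarrow> 'n state) \<Rightarrow> bool" where
  "closed_loop_solution f a \<phi>1 \<phi>2 b1 b2 \<theta>1 \<theta>2 \<delta> S \<longleftrightarrow>
    (\<forall>t\<ge>0. \<forall>i.
      ((\<lambda>\<tau>. st_x (S \<tau>) $ i) has_real_derivative
         b1 i * st_v (S t) $ i + \<phi>1 i (st_x (S t) $ i) * \<theta>1 i) (at t within {0..}) \<and>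
      ((\<lambda>\<tau>. st_v (S \<tau>) $ i) has_real_derivative
         b2 i * control f \<phi>1 \<phi>2 i (S t) + \<phi>2 i (st_x (S t) $ i, st_v (S t) $ i) * \<theta>2 i)
         (at t within {0..}) \<and>
      ((\<lambda>\<tau>. st_y (S \<tau>) $ i) has_real_derivative y_rate f i (S t)) (at t within {0..}) \<and>
      (\<forall>j. ((\<lambda>\<tau>. st_z (S \<tau>) $ i $ j) has_real_derivative
         - \<delta> i j * ((\<Sum>k\<in>UNIV. a i k * (st_z (S t) $ i $ j - st_z (S t) $ k $ j))
                     + a i j * (st_z (S t) $ i $ j - st_y (S t) $ j))) (at t within {0..})) \<and>
      ((\<lambda>\<tau>. st_k1 (S \<tau>) $ i) has_real_derivative
         (st_x (S t) $ i - st_y (S t) $ i) * eta1 \<phi>1 i (S t)) (at t within {0..}) \<and>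
      ((\<lambda>\<tau>. st_th1hat (S \<tau>) $ i) has_real_derivative
         \<phi>1 i (st_x (S t) $ i) * (st_x (S t) $ i - st_y (S t) $ i)) (at t within {0..}) \<and>
      ((\<lambda>\<tau>. st_k2 (S \<tau>) $ i) has_real_derivative
         beta \<phi>1 i (S t) * eta2 f \<phi>1 \<phi>2 i (S t)) (at t within {0..}) \<and>
      ((\<lambda>\<tau>. st_th2bar (S \<tau>) $ i) has_real_derivative
         beta \<phi>1 i (S t) * \<phi>2 i (st_x (S t) $ i, st_v (S t) $ i)) (at t within {0..}) \<and>
      ((\<lambda>\<tau>. st_th1bar (S \<tau>) $ i) has_real_derivative
         beta \<phi>1 i (S t) * Psi1 \<phi>1 i (S t)) (at t within {0..}) \<and>
      ((\<lambda>\<tau>. st_b1bar (S \<tau>) $ i) has_real_derivative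
         beta \<phi>1 i (S t) * Psi3 \<phi>1 i (S t)) (at t within {0..}))"

definition bounded_signal :: "(real \<Rightarrow> 'a::metric_space) \<Rightarrow> bool" where
  "bounded_signal w \<longleftrightarrow> bounded (w ` {0..})"

end

theory Submission
  imports Defs
begin

text \<open>
  The controller splits into a part that searches for the equilibrium and a part that makes the
  actions follow the search, and the proof follows this split.

  The variables \<open>y\<close> and \<open>z\<close> evolve autonomously. If every estimate \<open>z\<^sub>i\<^sub>j\<close> were equal to \<open>y\<^sub>j\<close>, then \<open>y\<close>
  would follow the negative pseudo-gradient, which strong monotonicity contracts towards its zero, the
  Nash equilibrium. The estimation errors \<open>z\<^sub>i\<^sub>j - y\<^sub>j\<close> are contracted at a speed proportional to \<open>\<delta>\<close>, because the
  Laplacian of a connected graph that is grounded at the neighbours of \<open>j\<close> is positive definite. For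
  large \<open>\<delta>\<close> the two contractions dominate the cross terms, so that a quadratic function of
  \<open>y - x\<^sup>*\<close> and of the errors is dissipated (\<open>seeking_dissipation\<close>). In particular the squares of
  \<open>y - x\<^sup>*\<close> and of the derivative of \<open>y\<close> are integrable over time.

  For each player, backstepping provides quadratic functions of the tracking error \<open>x\<^sub>i - y\<^sub>i\<close>, of \<open>\<beta>\<^sub>i\<close> and of the
  parameter errors. Their derivatives consist of a negative square and a term \<open>(b N\<^sub>0(k) + 1) k'\<close>
  with the unknown gain \<open>b\<close>. The latter is the derivative of an explicit function of \<open>k\<close> alone, the
  \<open>nussbaum_primitive\<close>. After subtraction of this primitive a nonincreasing function is left
  (\<open>W_beta_rate_along_loop\<close>). The primitive is therefore bounded below along the motion; since it takes
  arbitrarily low values at points \<open>p\<close> and \<open>- p\<close> arbitrarily far out, whatever the sign of \<open>b\<close>, the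
  continuous function \<open>k\<close> is trapped between two such points. So \<open>k\<close> is bounded, and then all other
  terms are. The coupling of \<open>x\<^sub>i - y\<^sub>i\<close> with \<open>\<beta>\<^sub>i\<close> and with the derivative of \<open>y\<^sub>i\<close> is absorbed by
  adding multiples of the dissipated functions of the other two parts (\<open>W_total_rate_le\<close>), so no integral
  over time is ever formed. Convergence of \<open>y\<close> and of \<open>x - y\<close> follows from Barbalat's argument
  (\<open>barbalat_dissipation\<close>).

  All bounds depend on the initial state only, not on the length of the time interval. They are
  formulated as boundedness of the set of reachable states, and they also give existence: cutting the
  vector field off outside a ball larger than the bound makes it bounded and globally Lipschitz, hence
  globally solvable by Picard iteration, and the solution never notices the cutoff
  (\<open>global_solution_of_a_priori_bound\<close>).
\<close>

section \<open>Global solutions of autonomous differential equations\<close>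

lemma indefinite_integral_has_vector_derivative:
  fixes g :: "real \<Rightarrow> 'a::banach"
  assumes "continuous_on {0..} g" and t: "t \<ge> 0"
  shows "((\<lambda>u. integral {0..u} g) has_vector_derivative g t) (at t within {0..})"
proof -
  have "((\<lambda>u. integral {0..u} g) has_vector_derivative g t) (at t within {0..t+1})"
    using t by (intro integral_has_vector_derivative continuous_on_subset[OF assms(1)]) auto
  moreover have "at t within {0..} = at t within {0..t+1}"
    by (rule at_within_nhd[where S="{t-1<..<t+1}"]) (use t in auto)
  ultimately show ?thesis by simp
qed

text \<open>
  The Lipschitz estimate of the Picard operator in the norm with weight \<open>exp (- \<mu> t)\<close>. The curves are given in
  rescaled form \<open>u s = exp (- \<mu> s) X s\<close>; integrating the factor \<open>exp (\<mu> s)\<close> gains the constant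
  \<open>1 / \<mu>\<close>, which makes the operator a contraction on the whole half-line once \<open>\<mu> > L\<close>.
\<close>

lemma exp_weighted_integral_le:
  fixes F :: "'a::euclidean_space \<Rightarrow> 'a" and u w :: "real \<Rightarrow> 'a"
  assumes F: "L-lipschitz_on UNIV F" and lam: "\<mu> > 0" and t: "t \<ge> 0"
    and u: "continuous_on UNIV u" and w: "continuous_on UNIV w"
    and d: "\<And>s. norm (u s - w s) \<le> d"
  shows "norm (integral {0..t} (\<lambda>s. F (exp (\<mu> * s) *\<^sub>R u s)) - integral {0..t} (\<lambda>s. F (exp (\<mu> * s) *\<^sub>R w s)))
    \<le> L * d / \<mu> * exp (\<mu> * t)"
proof -
  have L: "L \<ge> 0" using F lipschitz_on_nonneg by blast
  have cF: "continuous_on A F" for A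
    using F lipschitz_on_continuous_on continuous_on_subset by blast
  have d0: "d \<ge> 0" using d[of 0] norm_ge_zero order_trans by blast
  have c: "continuous_on A (\<lambda>s. F (exp (\<mu> * s) *\<^sub>R v s))" if "continuous_on UNIV v" for v A
    by (rule continuous_on_compose2[OF cF[of UNIV]])
       (auto intro!: continuous_intros continuous_on_subset[OF that])
  have e: "((\<lambda>s. (L*d) * exp (\<mu> * s)) has_integral (L*d/\<mu>) * exp (\<mu> * t) - (L*d/\<mu>) * exp (\<mu> * 0)) {0..t}"
    by (rule fundamental_theorem_of_calculus[OF t])
       (use lam in \<open>auto intro!: derivative_eq_intros simp: has_real_derivative_iff_has_vector_derivative[symmetric]\<close>)
  have "norm (integral {0..t} (\<lambda>s. F (exp (\<mu> * s) *\<^sub>R u s)) - integral {0..t} (\<lambda>s. F (exp (\<mu> * s) *\<^sub>R w s)))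
     = norm (integral {0..t} (\<lambda>s. F (exp (\<mu> * s) *\<^sub>R u s) - F (exp (\<mu> * s) *\<^sub>R w s)))"
    by (subst integral_diff) (auto intro!: integrable_continuous_real c u w)
  also have "\<dots> \<le> integral {0..t} (\<lambda>s. (L*d) * exp (\<mu> * s))"
  proof (rule integral_norm_bound_integral)
    show "(\<lambda>s. F (exp (\<mu> * s) *\<^sub>R u s) - F (exp (\<mu> * s) *\<^sub>R w s)) integrable_on {0..t}"
      by (intro integrable_continuous_real continuous_on_diff c u w)
    show "(\<lambda>s. L * d * exp (\<mu> * s)) integrable_on {0..t}" using e by blast
    fix s
    have "norm (F (exp (\<mu> * s) *\<^sub>R u s) - F (exp (\<mu> * s) *\<^sub>R w s))
       \<le> L * norm (exp (\<mu> * s) *\<^sub>R u s - exp (\<mu> * s) *\<^sub>R w s)"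
      using lipschitz_on_normD[OF F] by simp
    also have "\<dots> = L * (exp (\<mu> * s) * norm (u s - w s))"
      by (simp flip: scaleR_diff_right)
    also have "\<dots> \<le> L * (exp (\<mu> * s) * d)" using d L by (intro mult_left_mono) auto
    finally show "norm (F (exp (\<mu> * s) *\<^sub>R u s) - F (exp (\<mu> * s) *\<^sub>R w s)) \<le> L * d * exp (\<mu> * s)"
      by (simp add: mult_ac)
  qed
  also have "\<dots> = (L*d/\<mu>) * exp (\<mu> * t) - (L*d/\<mu>)" using integral_unique[OF e] by simp
  also have "\<dots> \<le> (L*d/\<mu>) * exp (\<mu> * t)" using L d0 lam by simp
  finally show ?thesis .
qed

text \<open>
  Picard iteration on all of \<open>[0, \<infinity>)\<close> at once. The Banach space consists of the bounded continuous functions; a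
  function \<open>u\<close> stands for the curve \<open>exp (\<mu> t) u t\<close>. Boundedness of the field keeps the
  integral in this space, as it grows at most linearly. Functions on the whole real line are used by freezing
  negative times at \<open>0\<close>.
\<close>

lemma global_solution_of_bounded_lipschitz_field:
  fixes F :: "'a::euclidean_space \<Rightarrow> 'a"
  assumes F: "L-lipschitz_on UNIV F" and bdd: "\<And>x. norm (F x) \<le> B"
  shows "\<exists>X. X 0 = x0 \<and> (\<forall>t\<ge>0. (X has_vector_derivative F (X t)) (at t within {0..}))"
proof -
  have L: "L \<ge> 0" using F lipschitz_on_nonneg by blast
  have B: "B \<ge> 0" using bdd[of 0] norm_ge_zero order_trans by blast
  \<comment> \<open>any weight larger than \<open>L\<close> makes the Picard operator a contraction\<close>
  define \<mu> where "\<mu> = L + 1"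
  have lam: "\<mu> > 0" using L by (simp add: \<mu>_def)
  have cF: "continuous_on UNIV F"
    using F lipschitz_on_continuous_on by blast
  have cg: "continuous_on A (\<lambda>s. F (exp (\<mu> * s) *\<^sub>R v s))" if "continuous_on UNIV v" for v A
    by (rule continuous_on_compose2[OF cF])
       (auto intro!: continuous_intros continuous_on_subset[OF that])
  define J where "J v t = integral {0..t} (\<lambda>s. F (exp (\<mu> * s) *\<^sub>R v s))" for v t
  have J_deriv: "(J v has_vector_derivative F (exp (\<mu> * t) *\<^sub>R v t)) (at t within {0..})"
    if "continuous_on UNIV v" "t \<ge> 0" for v t
    unfolding J_def by (rule indefinite_integral_has_vector_derivative[OF cg[OF that(1)] that(2)])
  have J_cont: "continuous_on {0..} (J v)" if "continuous_on UNIV v" for v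
    unfolding continuous_on_eq_continuous_within
    using J_deriv[OF that] has_vector_derivative_continuous by fastforce
  have J_bound: "norm (J v t) \<le> B * t" if "continuous_on UNIV v" "t \<ge> 0" for v t
  proof -
    have "norm (J v t) \<le> B * (t - 0)"
      unfolding J_def using that(2)
      by (rule integral_bound) (auto intro: cg that bdd)
    then show ?thesis by simp
  qed
  define P where "P v t = exp (- \<mu> * max 0 t) *\<^sub>R (x0 + J v (max 0 t))" for v t
  have P_mem: "P v \<in> bcontfun" if v: "continuous_on UNIV v" for v
  proof (rule bcontfun_normI)
    have "continuous_on UNIV (\<lambda>t. J v (max 0 t))"
      by (rule continuous_on_compose2[OF J_cont[OF v]]) (auto intro!: continuous_intros)
    then show "continuous_on UNIV (P v)" unfolding P_def by (intro continuous_intros)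
    fix t :: real
    let ?s = "max 0 t"
    have "\<mu> * ?s \<le> exp (\<mu> * ?s)" using exp_ge_add_one_self[of "\<mu> * ?s"] by linarith
    then have s: "exp (- \<mu> * ?s) * ?s \<le> 1 / \<mu>"
      using lam by (simp add: exp_minus field_simps)
    have "norm (P v t) = exp (- \<mu> * ?s) * norm (x0 + J v ?s)" by (simp add: P_def)
    also have "\<dots> \<le> exp (- \<mu> * ?s) * (norm x0 + B * ?s)"
      by (intro mult_left_mono norm_triangle_le add_left_mono J_bound v) auto
    also have "\<dots> = exp (- \<mu> * ?s) * norm x0 + B * (exp (- \<mu> * ?s) * ?s)" by (simp add: algebra_simps)
    also have "\<dots> \<le> 1 * norm x0 + B * (1 / \<mu>)"
      by (intro add_mono mult_right_mono mult_left_mono s B) (use lam in auto)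
    finally show "norm (P v t) \<le> norm x0 + B / \<mu>" by simp
  qed
  define T :: "(real \<Rightarrow>\<^sub>C 'a) \<Rightarrow> (real \<Rightarrow>\<^sub>C 'a)" where "T u = Bcontfun (P (apply_bcontfun u))" for u
  have T_apply: "apply_bcontfun (T u) = P (apply_bcontfun u)" for u
    unfolding T_def by (rule Bcontfun_inverse) (rule P_mem, simp)
  have contr: "dist (T u) (T w) \<le> L / \<mu> * dist u w" for u w
  proof (rule dist_bound)
    fix t :: real
    let ?s = "max 0 t"
    have "dist (T u t) (T w t) = exp (- \<mu> * ?s) * norm (J u ?s - J w ?s)"
      unfolding T_apply P_def dist_norm by (simp flip: scaleR_diff_right)
    also have "\<dots> \<le> exp (- \<mu> * ?s) * (L * dist u w / \<mu> * exp (\<mu> * ?s))"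
      unfolding J_def using dist_bounded[of u _ w]
      by (intro mult_left_mono exp_weighted_integral_le[OF F lam]) (auto simp: dist_norm)
    also have "\<dots> = L / \<mu> * dist u w" by (simp add: exp_minus)
    finally show "dist (T u t) (T w t) \<le> L / \<mu> * dist u w" .
  qed
  have "\<exists>!u. T u = u"
    by (rule banach_fix_type[where c="L/\<mu>"])
       (use L lam contr in \<open>auto simp: \<mu>_def\<close>)
  then obtain u where u: "T u = u" by blast
  define X where "X t = x0 + J u t" for t
  have X: "X t = exp (\<mu> * t) *\<^sub>R u t" if "t \<ge> 0" for t
  proof -
    have "apply_bcontfun u t = exp (- \<mu> * t) *\<^sub>R X t"
      using fun_cong[OF T_apply[of u], of t] that by (simp add: u P_def X_def)
    then show ?thesis by (simp add: exp_minus)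
  qed
  have "(X has_vector_derivative F (X t)) (at t within {0..})" if "t \<ge> 0" for t
    unfolding X[OF that] unfolding X_def[abs_def]
    by (rule derivative_eq_intros J_deriv that | simp)+
  moreover have "X 0 = x0" by (simp add: X_def J_def)
  ultimately show ?thesis by blast
qed

text \<open>
  The field is composed with the projection onto the ball of radius \<open>R + 1\<close>. A solution of the
  modified equation that left this ball would solve the original equation up to its first exit time, where the
  a priori bound \<open>R\<close> contradicts the norm \<open>R + 1\<close>.
\<close>

lemma global_solution_of_a_priori_bound:
  fixes F :: "'a::euclidean_space \<Rightarrow> 'a"
  assumes loc: "\<And>r. \<exists>L. L-lipschitz_on (cball 0 r) F"
    and bound: "\<And>T X. T \<ge> 0 \<Longrightarrow> X 0 = x0 \<Longrightarrow>
      (\<And>t. t \<in> {0..T} \<Longrightarrow> (X has_vector_derivative F (X t)) (at t within {0..T})) \<Longrightarrow> norm (X T) \<le> R"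
  shows "\<exists>X. X 0 = x0 \<and> (\<forall>t\<ge>0. (X has_vector_derivative F (X t)) (at t within {0..}))"
proof -
  let ?C = "cball (0::'a) (R + 1)"
  \<comment> \<open>the bound for the trivial time interval\<close>
  have "norm x0 \<le> R"
    by (rule bound[of 0 "\<lambda>_. x0", simplified]) 
       (auto simp: has_vector_derivative_def has_derivative_within_singleton_iff bounded_linear_scaleR_left)
  then have R: "R \<ge> 0" and x0: "norm x0 \<le> R" using norm_ge_zero order_trans by blast+
  have C: "convex ?C" "closed ?C" "?C \<noteq> {}" using R by auto
  obtain L where L: "L-lipschitz_on ?C F" using loc by blast
  define F' where "F' x = F (closest_point ?C x)" for x
  have "1-lipschitz_on UNIV (closest_point ?C)"
    using closest_point_lipschitz[OF C] by (auto intro!: lipschitz_onI)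
  moreover have "L-lipschitz_on (closest_point ?C ` UNIV) F"
    by (rule lipschitz_on_subset[OF L]) (use closest_point_in_set C in blast)
  ultimately have lip: "(L * 1)-lipschitz_on UNIV F'"
    unfolding F'_def[abs_def] by (rule lipschitz_on_compose2)
  have "bounded (F ` ?C)"
    using L by (intro compact_imp_bounded compact_continuous_image lipschitz_on_continuous_on[OF L]) auto
  then obtain B where "\<And>x. x \<in> ?C \<Longrightarrow> norm (F x) \<le> B" unfolding bounded_iff by blast
  then have B: "norm (F' x) \<le> B" for x
    unfolding F'_def using closest_point_in_set C by blast
  obtain X where X0: "X 0 = x0" and X: "\<And>t. t \<ge> 0 \<Longrightarrow> (X has_vector_derivative F' (X t)) (at t within {0..})"
    using global_solution_of_bounded_lipschitz_field[OF lip B, of x0] by blast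
  have F'_eq: "F' x = F x" if "norm x \<le> R + 1" for x
    using that by (simp add: F'_def closest_point_self)
  have contX: "continuous_on {0..} X"
    unfolding continuous_on_eq_continuous_within
    using X has_vector_derivative_continuous by fastforce
  have step: "norm (X T) \<le> R" if T: "T \<ge> 0" and le: "\<And>t. t \<in> {0..T} \<Longrightarrow> norm (X t) \<le> R + 1" for T
  proof (rule bound[of T X, OF T X0])
    fix t assume t: "t \<in> {0..T}"
    then have "(X has_vector_derivative F (X t)) (at t within {0..})"
      using X[of t] F'_eq[OF le[OF t]] by simp
    then show "(X has_vector_derivative F (X t)) (at t within {0..T})"
      by (rule has_vector_derivative_within_subset) auto
  qed
  have inside: "norm (X t) < R + 1" if t: "t \<ge> 0" for t
  proof (rule ccontr)
    assume far: "\<not> norm (X t) < R + 1"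
    let ?S = "{s\<in>{0..t}. R + 1 \<le> norm (X s)}"
    have cn: "continuous_on {0..t} (\<lambda>s. norm (X s))"
      by (intro continuous_on_norm continuous_on_subset[OF contX]) auto
    have "closed ?S"
      by (intro continuous_on_closed_Collect_le cn continuous_intros closed_atLeastAtMost)
    moreover have "?S \<subseteq> {0..t}" by auto
    ultimately have "compact ?S" by (meson bounded_closed_interval bounded_subset compact_eq_bounded_closed)
    moreover have "?S \<noteq> {}" using far t by auto
    ultimately obtain T where T: "T \<in> ?S" and first: "\<And>s. s \<in> ?S \<Longrightarrow> T \<le> s"
      using compact_attains_inf[of ?S] by blast
    \<comment> \<open>the norm is exactly \<open>R + 1\<close> at the first exit time, hence at most \<open>R + 1\<close> up to then\<close>
    have "\<exists>s. 0 \<le> s \<and> s \<le> T \<and> norm (X s) = R + 1"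
      by (rule IVT') (use T X0 x0 in \<open>auto intro: continuous_on_subset[OF cn]\<close>)
    then obtain s where s: "0 \<le> s" "s \<le> T" "norm (X s) = R + 1" by blast
    then have "s \<in> ?S" using T by auto
    then have "norm (X T) = R + 1" using first[of s] s by auto
    have "norm (X r) \<le> R + 1" if "r \<in> {0..T}" for r
    proof (cases "r = T")
      case False
      then have "r \<notin> ?S" using first[of r] that by auto
      then show ?thesis using that T by auto
    qed (use \<open>norm (X T) = R + 1\<close> in simp)
    then have "norm (X T) \<le> R" using step T by auto
    then show False using T by auto
  qed
  have "(X has_vector_derivative F (X t)) (at t within {0..})" if "t \<ge> 0" for t
    using X[OF that] F'_eq inside[OF that] by simp
  then show ?thesis using X0 by blast
qed

section \<open>Maps that are Lipschitz on bounded sets\<close>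

text \<open>
  In finite dimension this is equivalent to the usual local Lipschitz condition. It is the form that the cutoff
  outside a ball needs, and it passes directly to compositions.
\<close>

definition boundedly_lipschitz :: "('a::euclidean_space \<Rightarrow> 'b::real_normed_vector) \<Rightarrow> bool" where
  "boundedly_lipschitz F \<longleftrightarrow> (\<forall>r. \<exists>L. L-lipschitz_on (cball 0 r) F)"

lemma boundedly_lipschitz_bounded:
  assumes "boundedly_lipschitz F"
  shows "\<exists>B>0. \<forall>x\<in>cball 0 r. norm (F x) \<le> B"
proof -
  obtain L where "L-lipschitz_on (cball 0 r) F" using assms by (auto simp: boundedly_lipschitz_def)
  then have "compact (F ` cball 0 r)" by (intro compact_continuous_image lipschitz_on_continuous_on) auto
  then obtain B where "B > 0" "\<forall>y\<in>F ` cball 0 r. norm y \<le> B"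
    using compact_imp_bounded bounded_pos by metis
  then show ?thesis by auto
qed

lemma boundedly_lipschitz_compose:
  fixes G :: "'b::euclidean_space \<Rightarrow> 'c::real_normed_vector"
  assumes G: "boundedly_lipschitz G" and F: "boundedly_lipschitz F"
  shows "boundedly_lipschitz (\<lambda>x. G (F x))"
  unfolding boundedly_lipschitz_def
proof
  fix r
  obtain B where B: "\<And>x. x \<in> cball 0 r \<Longrightarrow> norm (F x) \<le> B" using boundedly_lipschitz_bounded[OF F] by blast
  obtain L where L: "L-lipschitz_on (cball 0 r) F" using F by (auto simp: boundedly_lipschitz_def)
  obtain M where M: "M-lipschitz_on (cball 0 B) G" using G by (auto simp: boundedly_lipschitz_def)
  have "M-lipschitz_on (F ` cball 0 r) G" by (rule lipschitz_on_subset[OF M]) (use B in auto)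
  then have "(M * L)-lipschitz_on (cball 0 r) (\<lambda>x. G (F x))" by (rule lipschitz_on_compose2[OF L])
  then show "\<exists>L. L-lipschitz_on (cball 0 r) (\<lambda>x. G (F x))" by blast
qed

lemma lipschitz_imp_boundedly_lipschitz: "L-lipschitz_on UNIV F \<Longrightarrow> boundedly_lipschitz F"
  unfolding boundedly_lipschitz_def using lipschitz_on_subset by blast

lemma bounded_linear_imp_boundedly_lipschitz:
  assumes "bounded_linear F"
  shows "boundedly_lipschitz F"
  using bounded_linear.lipschitz_boundE[OF assms] lipschitz_imp_boundedly_lipschitz by metis

text \<open>
  The partial derivatives are bounded on a closed ball by compactness, and they bound the operator norm of the
  derivative; balls are convex, so the mean value inequality applies.
\<close>

lemma C1_imp_boundedly_lipschitz:
  fixes g :: "'a::euclidean_space \<Rightarrow> real"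
  assumes "C_k 1 g"
  shows "boundedly_lipschitz g"
  unfolding boundedly_lipschitz_def
proof
  fix r
  have g: "(g has_derivative frechet_derivative g (at x)) (at x)" for x
    using assms by (simp add: differentiable_on_def frechet_derivative_works[symmetric])
  have "\<exists>B. \<forall>x\<in>cball 0 r. \<bar>frechet_derivative g (at x) b\<bar> \<le> B" if "b \<in> Basis" for b
  proof -
    have "continuous_on UNIV (\<lambda>x. frechet_derivative g (at x) b)" using assms that by simp
    then have "bounded ((\<lambda>x. frechet_derivative g (at x) b) ` cball 0 r)"
      by (intro compact_imp_bounded compact_continuous_image) (auto intro: continuous_on_subset)
    then show ?thesis by (auto simp: bounded_iff)
  qed
  then obtain B where B: "\<And>b x. b \<in> Basis \<Longrightarrow> x \<in> cball 0 r \<Longrightarrow> \<bar>frechet_derivative g (at x) b\<bar> \<le> B b"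
    by metis
  define K where "K = max 0 (\<Sum>b\<in>Basis. B b)"
  have "norm (g x - g y) \<le> K * norm (x - y)" if "x \<in> cball 0 r" "y \<in> cball 0 r" for x y
  proof (rule differentiable_bound[OF convex_cball])
    fix z :: 'a assume z: "z \<in> cball 0 r"
    let ?D = "frechet_derivative g (at z)"
    show "(g has_derivative ?D) (at z within cball 0 r)" by (rule has_derivative_at_withinI[OF g])
    have lin: "linear ?D" using g has_derivative_linear by blast
    show "onorm ?D \<le> K"
    proof (rule onorm_le)
      fix h
      have "?D h = ?D (\<Sum>b\<in>Basis. (h \<bullet> b) *\<^sub>R b)" by (simp add: euclidean_representation)
      also have "\<dots> = (\<Sum>b\<in>Basis. (h \<bullet> b) * ?D b)" by (simp add: linear_sum[OF lin] linear_scale[OF lin])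
      finally have "norm (?D h) \<le> (\<Sum>b\<in>Basis. \<bar>(h \<bullet> b) * ?D b\<bar>)" by simp
      also have "\<dots> \<le> (\<Sum>b\<in>Basis. norm h * B b)"
        unfolding abs_mult by (intro sum_mono mult_mono Basis_le_norm B z) auto
      also have "\<dots> = (\<Sum>b\<in>Basis. B b) * norm h" by (subst sum_distrib_right) (simp add: mult.commute)
      also have "\<dots> \<le> K * norm h" by (intro mult_right_mono) (auto simp: K_def)
      finally show "norm (?D h) \<le> K * norm h" .
    qed
  qed (use that in auto)
  then have "K-lipschitz_on (cball 0 r) g"
    by (intro lipschitz_onI) (auto simp: dist_norm K_def)
  then show "\<exists>L. L-lipschitz_on (cball 0 r) g" by blast
qed

lemma boundedly_lipschitz_Pair:
  fixes F :: "'a::euclidean_space \<Rightarrow> 'b::real_normed_vector" and G :: "'a \<Rightarrow> 'c::real_normed_vector"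
  assumes "boundedly_lipschitz F" "boundedly_lipschitz G"
  shows "boundedly_lipschitz (\<lambda>x. (F x, G x))"
  unfolding boundedly_lipschitz_def
proof
  fix r
  obtain L M where "L-lipschitz_on (cball 0 r) F" "M-lipschitz_on (cball 0 r) G"
    using assms unfolding boundedly_lipschitz_def by meson
  then show "\<exists>L. L-lipschitz_on (cball 0 r) (\<lambda>x. (F x, G x))" using lipschitz_on_Pair by blast
qed

lemma boundedly_lipschitz_vec:
  fixes F :: "'n::finite \<Rightarrow> 'a::euclidean_space \<Rightarrow> 'b::real_normed_vector"
  assumes "\<And>i. boundedly_lipschitz (F i)"
  shows "boundedly_lipschitz (\<lambda>x. \<chi> i. F i x)"
  unfolding boundedly_lipschitz_def
proof
  fix r
  have "\<forall>i. \<exists>L. L-lipschitz_on (cball 0 r) (F i)"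
    using assms by (simp add: boundedly_lipschitz_def)
  then obtain L where L: "\<And>i. (L i)-lipschitz_on (cball 0 r) (F i)"
    by metis
  have "(\<Sum>i\<in>UNIV. L i)-lipschitz_on (cball 0 r) (\<lambda>x. \<chi> i. F i x)"
  proof (rule lipschitz_onI)
    fix x y :: 'a assume xy: "x \<in> cball 0 r" "y \<in> cball 0 r"
    have "dist (\<chi> i. F i x) (\<chi> i. F i y) \<le> (\<Sum>i\<in>UNIV. dist (F i x) (F i y))"
      unfolding dist_vec_def by (rule order_trans[OF L2_set_le_sum]) auto
    also have "\<dots> \<le> (\<Sum>i\<in>UNIV. L i * dist x y)"
      by (intro sum_mono lipschitz_onD[OF L] xy)
    finally show "dist (\<chi> i. F i x) (\<chi> i. F i y) \<le> (\<Sum>i\<in>UNIV. L i) * dist x y"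
      by (simp add: sum_distrib_right)
  qed (use L lipschitz_on_nonneg in \<open>blast intro: sum_nonneg\<close>)
  then show "\<exists>L. L-lipschitz_on (cball 0 r) (\<lambda>x. \<chi> i. F i x)" by blast
qed

lemma boundedly_lipschitz_const: "boundedly_lipschitz (\<lambda>_. c)"
  unfolding boundedly_lipschitz_def using lipschitz_on_constant by blast

text \<open>
  Both factors are bounded on each ball, so the product rule for differences applies.
\<close>

lemma boundedly_lipschitz_mult:
  fixes F G :: "'a::euclidean_space \<Rightarrow> real"
  assumes F: "boundedly_lipschitz F" and G: "boundedly_lipschitz G"
  shows "boundedly_lipschitz (\<lambda>x. F x * G x)"
  unfolding boundedly_lipschitz_def
proof
  fix r
  obtain A where A: "A > 0" "\<And>x. x \<in> cball 0 r \<Longrightarrow> \<bar>F x\<bar> \<le> A"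
    using boundedly_lipschitz_bounded[OF F, of r] by auto
  obtain B where B: "B > 0" "\<And>x. x \<in> cball 0 r \<Longrightarrow> \<bar>G x\<bar> \<le> B"
    using boundedly_lipschitz_bounded[OF G, of r] by auto
  obtain L M where L: "L-lipschitz_on (cball 0 r) F" and M: "M-lipschitz_on (cball 0 r) G"
    using F G unfolding boundedly_lipschitz_def by meson
  have "(A * M + B * L)-lipschitz_on (cball 0 r) (\<lambda>x. F x * G x)"
  proof (rule lipschitz_onI)
    fix x y :: 'a assume xy: "x \<in> cball 0 r" "y \<in> cball 0 r"
    have "F x * G x - F y * G y = F x * (G x - G y) + G y * (F x - F y)" by (simp add: algebra_simps)
    then have "dist (F x * G x) (F y * G y) \<le> \<bar>F x\<bar> * dist (G x) (G y) + \<bar>G y\<bar> * dist (F x) (F y)"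
      unfolding dist_real_def by (metis abs_mult abs_triangle_ineq)
    also have "\<dots> \<le> A * (M * dist x y) + B * (L * dist x y)"
      by (intro add_mono mult_mono A B lipschitz_onD[OF L] lipschitz_onD[OF M] xy) (use A B in auto)
    finally show "dist (F x * G x) (F y * G y) \<le> (A * M + B * L) * dist x y" by (simp add: algebra_simps)
  qed (use A B lipschitz_on_nonneg[OF L] lipschitz_on_nonneg[OF M] in simp)
  then show "\<exists>L. L-lipschitz_on (cball 0 r) (\<lambda>x. F x * G x)" by blast
qed

lemma boundedly_lipschitz_add_diff:
  fixes F G :: "'a::euclidean_space \<Rightarrow> real"
  assumes "boundedly_lipschitz F" "boundedly_lipschitz G"
  shows "boundedly_lipschitz (\<lambda>x. F x + G x)" "boundedly_lipschitz (\<lambda>x. F x - G x)"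
proof -
  have "\<exists>L. L-lipschitz_on (cball 0 r) (\<lambda>x. F x + G x)" "\<exists>L. L-lipschitz_on (cball 0 r) (\<lambda>x. F x - G x)" for r
  proof -
    obtain L M where "L-lipschitz_on (cball 0 r) F" "M-lipschitz_on (cball 0 r) G"
      using assms unfolding boundedly_lipschitz_def by meson
    then show "\<exists>L. L-lipschitz_on (cball 0 r) (\<lambda>x. F x + G x)" "\<exists>L. L-lipschitz_on (cball 0 r) (\<lambda>x. F x - G x)"
      using lipschitz_on_add lipschitz_on_diff by blast+
  qed
  then show "boundedly_lipschitz (\<lambda>x. F x + G x)" "boundedly_lipschitz (\<lambda>x. F x - G x)"
    by (simp_all add: boundedly_lipschitz_def)
qed

lemma boundedly_lipschitz_minus:
  fixes F :: "'a::euclidean_space \<Rightarrow> real"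
  assumes "boundedly_lipschitz F"
  shows "boundedly_lipschitz (\<lambda>x. - F x)"
  using boundedly_lipschitz_add_diff(2)[OF boundedly_lipschitz_const[of 0] assms] by simp

lemma boundedly_lipschitz_square:
  fixes F :: "'a::euclidean_space \<Rightarrow> real"
  assumes "boundedly_lipschitz F"
  shows "boundedly_lipschitz (\<lambda>x. (F x)\<^sup>2)"
  unfolding power2_eq_square by (intro boundedly_lipschitz_mult assms)

lemma boundedly_lipschitz_sum:
  fixes F :: "'i \<Rightarrow> 'a::euclidean_space \<Rightarrow> real"
  assumes "\<And>i. boundedly_lipschitz (F i)"
  shows "boundedly_lipschitz (\<lambda>x. \<Sum>i\<in>I. F i x)"
proof (cases "finite I")
  case True
  then show ?thesis
    by induction (auto intro: boundedly_lipschitz_const boundedly_lipschitz_add_diff assms)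
qed (simp add: boundedly_lipschitz_const)

lemma boundedly_lipschitz_sin_cos:
  fixes F :: "'a::euclidean_space \<Rightarrow> real"
  assumes "boundedly_lipschitz F"
  shows "boundedly_lipschitz (\<lambda>x. sin (F x))" "boundedly_lipschitz (\<lambda>x. cos (F x))"
proof -
  have "1-lipschitz_on UNIV (sin :: real \<Rightarrow> real)" "1-lipschitz_on UNIV (cos :: real \<Rightarrow> real)"
    using field_differentiable_bound[of UNIV "sin :: real \<Rightarrow> real" cos 1]
      field_differentiable_bound[of UNIV "cos :: real \<Rightarrow> real" "\<lambda>x. - sin x" 1]
    by (auto intro!: lipschitz_onI derivative_eq_intros simp: dist_norm)
  note this[THEN lipschitz_imp_boundedly_lipschitz]
  then show "boundedly_lipschitz (\<lambda>x. sin (F x))" "boundedly_lipschitz (\<lambda>x. cos (F x))"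
    by (blast intro: boundedly_lipschitz_compose[OF _ assms])+
qed

lemmas boundedly_lipschitz_intros =
  boundedly_lipschitz_const boundedly_lipschitz_add_diff boundedly_lipschitz_mult boundedly_lipschitz_minus
  boundedly_lipschitz_square boundedly_lipschitz_sum boundedly_lipschitz_sin_cos boundedly_lipschitz_Pair
  boundedly_lipschitz_vec

lemma frechet_derivative_eq_deriv:
  fixes g :: "real \<Rightarrow> real"
  assumes "g differentiable (at x)"
  shows "frechet_derivative g (at x) = (*) (deriv g x)"
proof -
  have "(g has_derivative (*) (deriv g x)) (at x)"
    using assms DERIV_deriv_iff_real_differentiable[of g x] by (simp add: has_field_derivative_def)
  then show ?thesis by (rule frechet_derivative_at[symmetric])
qed

lemma smooth_real_deriv:
  fixes g :: "real \<Rightarrow> real"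
  assumes "smooth g"
  shows "(g has_real_derivative deriv g x) (at x)" and "C_k 1 (deriv g)"
proof -
  have "C_k 2 g" using assms by (simp add: smooth_def)
  then have g: "g differentiable (at x)" and 1: "C_k 1 (\<lambda>x. frechet_derivative g (at x) 1)" for x
    by (auto simp: numeral_2_eq_2 differentiable_on_def)
  then show "(g has_real_derivative deriv g x) (at x)" by (simp add: DERIV_deriv_iff_real_differentiable)
  show "C_k 1 (deriv g)" using 1 by (simp only: frechet_derivative_eq_deriv[OF g] mult_1_right)
qed

lemma smooth_imp_continuous: "smooth g \<Longrightarrow> continuous_on UNIV g"
  unfolding smooth_def using C_k.simps(1) by blast

section \<open>Lyapunov arguments with dissipation\<close>

lemma decrease_at_rate:
  fixes Q :: "real \<Rightarrow> real"
  assumes Q: "\<And>r. r \<in> {s..t} \<Longrightarrow> (Q has_real_derivative Q' r) (at r within {s..t})"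
    and st: "s \<le> t" and d: "\<And>r. r \<in> {s..t} \<Longrightarrow> Q' r \<le> - d"
  shows "Q t - Q s \<le> - d * (t - s)"
proof (cases "s = t")
  case False
  have "\<exists>r\<in>{s<..<t}. Q t - Q s = (t - s) * Q' r"
  proof (rule mvt_simple[of s t Q "\<lambda>r h. h * Q' r", simplified])
    show "s < t" using st False by simp
    fix r assume "s \<le> r" "r \<le> t"
    then show "(Q has_derivative (\<lambda>h. h * Q' r)) (at r within {s..t})"
      using Q[of r] by (auto simp: has_field_derivative_def mult_commute_abs)
  qed
  then obtain r where "s < r" "r < t" "Q t - Q s = (t - s) * Q' r" by auto
  then show ?thesis using d[of r] st mult_left_mono[of "Q' r" "-d" "t - s"] by (simp add: mult.commute)
qed simp

text \<open>
  Barbalat's argument with a dissipation inequality in the place of the integrability of \<open>g\<^sup>2\<close>: since \<open>g\<close> is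
  Lipschitz, a time at which \<open>\<bar>g\<bar>\<close> is at least \<open>e\<close> is followed by an interval of fixed length \<open>h\<close> on
  which \<open>\<bar>g\<bar>\<close> is at least \<open>e / 2\<close>, so that \<open>Q\<close> drops by the fixed amount \<open>d h\<close>. This cannot happen once
  \<open>Q\<close> is within \<open>d h\<close> of its infimum.
\<close>

lemma barbalat_dissipation:
  fixes g Q g' Q' :: "real \<Rightarrow> real"
  assumes Q: "\<And>t. t \<ge> 0 \<Longrightarrow> (Q has_real_derivative Q' t) (at t within {0..})"
    and diss: "\<And>t. t \<ge> 0 \<Longrightarrow> Q' t \<le> - c * (g t)\<^sup>2" and c: "c > 0"
    and below: "\<And>t. t \<ge> 0 \<Longrightarrow> Q t \<ge> q"
    and g: "\<And>t. t \<ge> 0 \<Longrightarrow> (g has_real_derivative g' t) (at t within {0..})"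
    and g': "\<And>t. t \<ge> 0 \<Longrightarrow> \<bar>g' t\<bar> \<le> K"
  shows "(g \<longlongrightarrow> 0) at_top"
proof -
  have decr: "Q t - Q s \<le> - d * (t - s)"
    if st: "0 \<le> s" "s \<le> t" and d: "\<And>r. s \<le> r \<Longrightarrow> r \<le> t \<Longrightarrow> Q' r \<le> - d" for s t d
  proof (rule decrease_at_rate)
    fix r assume "r \<in> {s..t}"
    then show "(Q has_real_derivative Q' r) (at r within {s..t})"
      using st by (intro DERIV_subset[OF Q]) auto
  qed (use st d in auto)
  have lip: "\<bar>g t - g s\<bar> \<le> K * (t - s)" if "0 \<le> s" "s \<le> t" for s t
  proof -
    have "norm (g t - g s) \<le> K * norm (t - s)"
    proof (rule field_differentiable_bound[of "{0..}" g g' K t s])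
      show "convex {0::real..}" by simp
    qed (use that g g' in auto)
    then show ?thesis using that by simp
  qed
  have K: "K \<ge> 0" using g'[of 0] by simp
  show ?thesis
  proof (rule tendstoI)
    fix e :: real assume e: "e > 0"
    \<comment> \<open>\<open>g\<close> changes by at most \<open>e / 2\<close> in time \<open>h\<close>; the summand \<open>1\<close> avoids division by zero\<close>
    define h where "h = e / (2 * (K + 1))"
    have h: "h > 0" "K * h \<le> e / 2" using e K by (auto simp: h_def field_simps)
    let ?I = "Inf (Q ` {0..})"
    have bb: "bdd_below (Q ` {0..})" using below by (auto intro!: bdd_belowI)
    define d where "d = c * (e/2)\<^sup>2"
    have d: "d > 0" using c e by (simp add: d_def)
    have "?I < ?I + d * h" using d h by simp
    then obtain T where T: "T \<ge> 0" "Q T < ?I + d * h"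
      using cInf_lessD[of "Q ` {0..}" "?I + d * h"] by auto
    have "dist (g t) 0 < e" if t: "t \<ge> T" for t
    proof (rule ccontr)
      assume "\<not> dist (g t) 0 < e"
      then have big: "\<bar>g t\<bar> \<ge> e" by simp
      have "Q' r \<le> - d" if r: "t \<le> r" "r \<le> t + h" for r
      proof -
        have "K * (r - t) \<le> K * h" using r K by (intro mult_left_mono) auto
        then have "\<bar>g r - g t\<bar> \<le> e / 2" using lip[of t r] r t T h by linarith
        then have "e / 2 \<le> \<bar>g r\<bar>" using big by linarith
        then have "(e/2)\<^sup>2 \<le> (g r)\<^sup>2" using e by (metis abs_le_square_iff abs_of_pos half_gt_zero)
        then show ?thesis using diss[of r] c r t T mult_left_mono[of "(e/2)\<^sup>2" "(g r)\<^sup>2" c]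
          unfolding d_def by linarith
      qed
      then have "Q (t + h) - Q t \<le> - d * h" using decr[of t "t+h" d] t T h by simp
      moreover have "Q t - Q T \<le> - 0 * (t - T)"
      proof (rule decr)
        fix r assume "T \<le> r"
        then show "Q' r \<le> - 0" using diss[of r] T mult_nonneg_nonneg[of c "(g r)\<^sup>2"] c zero_le_power2[of "g r"] by linarith
      qed (use T t in auto)
      moreover have "?I \<le> Q (t + h)" using t T h by (intro cInf_lower bb) auto
      ultimately show False using T by simp
    qed
    then show "\<forall>\<^sub>F t in at_top. dist (g t) 0 < e" unfolding eventually_at_top_linorder by blast
  qed
qed

section \<open>The Nussbaum gain\<close>

text \<open>
  The antiderivative of \<open>b N\<^sub>0(k) + 1\<close>, that is, of \<open>b k\<^sup>2 sin k + 1\<close>.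
\<close>

definition nussbaum_primitive :: "real \<Rightarrow> real \<Rightarrow> real" where
  "nussbaum_primitive b k = b * (2 * k * sin k + 2 * cos k - k\<^sup>2 * cos k) + k"

lemma nussbaum_primitive_deriv:
  "(nussbaum_primitive b has_real_derivative b * N0 k + 1) (at k)"
  unfolding nussbaum_primitive_def[abs_def] N0_def
  by (rule derivative_eq_intros refl | simp add: algebra_simps power2_eq_square)+

text \<open>
  At a multiple \<open>p\<close> of \<open>\<pi>\<close> whose parity is chosen such that \<open>b cos p = \<bar>b\<bar>\<close>, the sine vanishes and the primitive
  equals \<open>2 \<bar>b\<bar> - \<bar>b\<bar> p\<^sup>2 + p\<close>. As the cosine is even, the same choice serves \<open>- p\<close>. This is where the
  growth and the oscillation of the Nussbaum function overcome the unknown sign of \<open>b\<close>.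
\<close>

lemma nussbaum_primitive_unbounded_below:
  assumes b: "b \<noteq> 0"
  shows "\<exists>p>r. nussbaum_primitive b p < - C \<and> nussbaum_primitive b (- p) < - C"
proof -
  define D where "D = \<bar>b\<bar>"
  have D: "D > 0" using b by (simp add: D_def)
  \<comment> \<open>large enough for \<open>D p\<^sup>2\<close> to dominate \<open>\<bar>C\<bar> + 2 D + 2 p\<close>, using \<open>p \<ge> n\<close>\<close>
  obtain n :: nat where n: "real n > max \<bar>r\<bar> (max 1 ((\<bar>C\<bar> + 2 * D + 2) / D + 2 / D))"
    using reals_Archimedean2 by blast
  define p where "p = (if b > 0 then 2 * pi * real n else (2 * real n + 1) * pi)"
  have cosp: "b * cos p = D"
  proof (cases "b > 0")
    case True
    then show ?thesis using cos_2npi[of n] by (simp add: p_def D_def mult_ac)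
  next
    case False
    then show ?thesis using cos_npi[of "2*n+1"] b by (simp add: p_def D_def mult_ac add.commute)
  qed
  have sinp: "sin p = 0"
  proof (cases "b > 0")
    case True
    then show ?thesis using sin_2npi[of n] by (simp add: p_def mult_ac)
  next
    case False
    then show ?thesis using sin_npi[of "2*n+1"] by (simp add: p_def mult_ac add.commute)
  qed
  have "1 * real n \<le> pi * real n" using pi_ge_two by (intro mult_right_mono) auto
  moreover have "p = 2 * (pi * real n) \<or> p = 2 * (pi * real n) + pi"
    by (auto simp: p_def algebra_simps)
  ultimately have pn: "p \<ge> real n" using pi_ge_zero by linarith
  have p1: "p > \<bar>r\<bar>" "p > 1" using n pn by auto
  have "p > (\<bar>C\<bar> + 2 * D + 2) / D + 2 / D" using n pn by linarith
  then have "D * p > \<bar>C\<bar> + 2 * D + 2 + 2" using D by (simp add: field_simps)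
  then have "p * (D * p) > p * (\<bar>C\<bar> + 2 * D + 2)" using p1 by (intro mult_strict_left_mono) auto
  moreover have "p * (\<bar>C\<bar> + 2 * D + 2) \<ge> 1 * (\<bar>C\<bar> + 2 * D) + p * 2"
    using p1 D mult_right_mono[of 1 p "\<bar>C\<bar> + 2 * D"] by (simp add: algebra_simps)
  ultimately have "D * p\<^sup>2 > \<bar>C\<bar> + 2 * D + 2 * p" by (simp add: power2_eq_square mult_ac)
  moreover have "nussbaum_primitive b q = 2 * D - D * q\<^sup>2 + q" if "q = p \<or> q = - p" for q
    using that sinp cosp[symmetric] unfolding nussbaum_primitive_def by (auto simp: algebra_simps)
  ultimately show ?thesis using p1
    by (intro exI[of _ p]) auto
qed

text \<open>
  A continuous gain cannot cross the points \<open>p\<close> and \<open>- p\<close> at which the primitive lies below the bound \<open>- C\<close>. The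
  constant \<open>K\<close> is chosen before the time \<open>T\<close> and the function \<open>k\<close>, so it is uniform over all solutions with
  the same initial value.
\<close>

lemma nussbaum_gain_bounded:
  assumes b: "b \<noteq> 0"
  shows "\<exists>K. \<forall>T\<ge>0. \<forall>k :: real \<Rightarrow> real. continuous_on {0..T} k \<longrightarrow> k 0 = k0 \<longrightarrow>
    (\<forall>t\<in>{0..T}. nussbaum_primitive b (k t) \<ge> - C) \<longrightarrow> \<bar>k T\<bar> \<le> K"
proof -
  obtain p where p: "p > \<bar>k0\<bar>" "nussbaum_primitive b p < - C" "nussbaum_primitive b (- p) < - C"
    using nussbaum_primitive_unbounded_below[OF b] by blast
  have "\<bar>k T\<bar> \<le> p" if T: "0 \<le> T" and c: "continuous_on {0..T} k" and k0: "k 0 = k0"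
      and low: "\<forall>t\<in>{0..T}. nussbaum_primitive b (k t) \<ge> - C" for T :: real and k :: "real \<Rightarrow> real"
  proof (rule ccontr)
    assume "\<not> \<bar>k T\<bar> \<le> p"
    then have "\<exists>t\<ge>0. t \<le> T \<and> \<bar>k t\<bar> = p"
      using T c k0 p by (intro IVT'[of "\<lambda>t. \<bar>k t\<bar>" 0 p T]) (auto intro!: continuous_intros)
    then obtain t where t: "t \<in> {0..T}" and "k t = p \<or> k t = - p" by (auto simp: abs_if split: if_splits)
    then have "nussbaum_primitive b (k t) < - C" using p by auto
    then show False using bspec[OF low t] by linarith
  qed
  then show ?thesis by blast
qed

section \<open>The Nash equilibrium as zero of the pseudo-gradient\<close>

lemma deviate_at_self [simp]: "deviate x i (x $ i) = x"
  by (simp add: deviate_def vec_eq_iff)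

lemma deviate_nth: "deviate x i r $ j = (if j = i then r else x $ j)"
  by (simp add: deviate_def)

lemma deviate_deviate [simp]: "deviate (deviate x i r) i = deviate x i"
  by (rule ext) (simp add: deviate_def vec_eq_iff)

lemma cost_deviate_deriv:
  fixes g :: "real ^ 'n::finite \<Rightarrow> real"
  assumes "C_k 1 g"
  shows "((\<lambda>r. g (deviate x i r)) has_real_derivative partial i g (deviate x i r)) (at r)"
proof -
  have g: "g differentiable (at y)" for y
    using assms by (simp add: differentiable_on_def)
  define u where "u = deviate x i 0"
  have line: "deviate x i = (\<lambda>r. u + r *\<^sub>R axis i 1)"
    by (auto simp: u_def deviate_def vec_eq_iff axis_def)
  have "(\<lambda>r. g (deviate x i r)) differentiable (at r)"
    unfolding line
    by (rule differentiable_compose[OF g]) (auto intro!: derivative_intros)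
  then show ?thesis
    unfolding partial_def deviate_deviate deviate_nth
    by (simp add: DERIV_deriv_iff_real_differentiable)
qed

lemma nash_imp_pseudo_gradient_zero:
  fixes f :: "'n::finite \<Rightarrow> real ^ 'n \<Rightarrow> real"
  assumes "\<And>i. C_k 1 (f i)" and "nash_equilibrium f x"
  shows "pseudo_gradient f x = 0"
proof -
  have "partial i (f i) x = 0" for i
  proof (rule DERIV_local_min[where d = 1])
    show "((\<lambda>r. f i (deviate x i r)) has_real_derivative partial i (f i) x) (at (x $ i))"
      using cost_deviate_deriv[OF assms(1), of i x i "x $ i"] by simp
  qed (use assms(2) in \<open>auto simp: nash_equilibrium_def\<close>)
  then show ?thesis by (simp add: pseudo_gradient_def vec_eq_iff)
qed

text \<open>
  Under a unilateral deviation only the component of the deviating player changes, so monotonicity of the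
  pseudo-gradient says that the derivative of this player's cost along the deviation never has the sign
  opposite to the deviation.
\<close>

lemma pseudo_gradient_zero_imp_nash:
  fixes f :: "'n::finite \<Rightarrow> real ^ 'n \<Rightarrow> real"
  assumes C1: "\<And>i. C_k 1 (f i)"
    and mono: "\<And>x z. (x - z) \<bullet> (pseudo_gradient f x - pseudo_gradient f z) \<ge> 0"
    and zero: "pseudo_gradient f x = 0"
  shows "nash_equilibrium f x"
  unfolding nash_equilibrium_def
proof (intro allI)
  fix i r
  let ?g = "\<lambda>r. f i (deviate x i r)" and ?g' = "\<lambda>r. partial i (f i) (deviate x i r)"
  have slope: "(s - x $ i) * ?g' s \<ge> 0" for s
  proof -
    let ?y = "deviate x i s"
    have "(?y - x) \<bullet> (pseudo_gradient f ?y - pseudo_gradient f x)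
       = (\<Sum>j\<in>UNIV. if j = i then (s - x $ i) * ?g' s else 0)"
      unfolding zero inner_vec_def
      by (rule sum.cong) (auto simp: deviate_nth pseudo_gradient_def)
    then show ?thesis using mono[of ?y x] by simp
  qed
  have d: "(?g has_real_derivative ?g' s) (at s)" for s by (rule cost_deviate_deriv[OF C1])
  have stationary: "?g' (x $ i) = 0" using zero by (simp add: pseudo_gradient_def vec_eq_iff)
  have right: "?g' s \<ge> 0" if "x $ i \<le> s" for s
    using slope[of s] stationary that by (cases "s = x $ i") (auto simp: zero_le_mult_iff)
  have left: "?g' s \<le> 0" if "s \<le> x $ i" for s
    using slope[of s] stationary that by (cases "s = x $ i") (auto simp: zero_le_mult_iff)
  have "?g (x $ i) \<le> ?g r"
  proof (cases "x $ i \<le> r")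
    case True
    then show ?thesis
      by (rule DERIV_nonneg_imp_nondecreasing[where f = ?g]) (use d right in blast)
  next
    case False
    then have "r \<le> x $ i" by simp
    then show ?thesis
      by (rule DERIV_nonpos_imp_nonincreasing[where f = ?g]) (use d left in blast)
  qed
  then show "f i x \<le> f i (deviate x i r)" by simp
qed

text \<open>
  A gradient step \<open>x \<mapsto> x - g P x\<close> satisfies
  \<open>\<parallel>T x - T z\<parallel>\<^sup>2 \<le> (1 - 2 g m + g\<^sup>2 K\<^sup>2) \<parallel>x - z\<parallel>\<^sup>2\<close>, and the step size \<open>g = m / K\<^sup>2\<close> minimises the
  factor. Its fixed point is the zero.
\<close>

lemma strongly_monotone_lipschitz_has_zero:
  fixes P :: "'a::euclidean_space \<Rightarrow> 'a"
  assumes m: "m > 0"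
    and mono: "\<And>x z. (x - z) \<bullet> (P x - P z) \<ge> m * (norm (x - z))\<^sup>2"
    and lip: "\<And>x z. norm (P x - P z) \<le> L * norm (x - z)"
  shows "\<exists>x. P x = 0"
proof -
  \<comment> \<open>a Lipschitz constant that is not below \<open>m\<close>, so that the contraction factor \<open>q\<close> is not negative\<close>
  define K where "K = max L m"
  have K: "K > 0" "m \<le> K" using m by (auto simp: K_def)
  have lipK: "norm (P x - P z) \<le> K * norm (x - z)" for x z
    using lip[of x z] mult_right_mono[of L K "norm (x - z)"] by (auto simp: K_def)
  define g where "g = m / K\<^sup>2"
  have g: "g > 0" using m K by (simp add: g_def)
  define q where "q = 1 - (m / K)\<^sup>2"
  have q: "0 \<le> q" "q < 1" using m K by (auto simp: q_def power_le_one)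
  define T where "T x = x - g *\<^sub>R P x" for x
  have "norm (T x - T z) \<le> sqrt q * norm (x - z)" for x z
  proof -
    have "(norm (T x - T z))\<^sup>2 = (norm (x - z))\<^sup>2 - 2 * g * ((x - z) \<bullet> (P x - P z)) + g\<^sup>2 * (norm (P x - P z))\<^sup>2"
      unfolding T_def power2_norm_eq_inner
      by (simp add: algebra_simps inner_commute power2_eq_square)
    also have "\<dots> \<le> (norm (x - z))\<^sup>2 - 2 * g * (m * (norm (x - z))\<^sup>2) + g\<^sup>2 * (K * norm (x - z))\<^sup>2"
      by (intro add_mono diff_mono mult_left_mono mono power_mono lipK) (use g in auto)
    also have "\<dots> = (1 - 2 * g * m + g\<^sup>2 * K\<^sup>2) * (norm (x - z))\<^sup>2"
      by (simp add: algebra_simps power_mult_distrib)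
    also have "1 - 2 * g * m + g\<^sup>2 * K\<^sup>2 = q"
      using K by (simp add: q_def g_def field_simps power2_eq_square)
    also have "q * (norm (x - z))\<^sup>2 = (sqrt q * norm (x - z))\<^sup>2"
      using q by (simp add: power_mult_distrib)
    finally show ?thesis by (rule power2_le_imp_le) (use q in simp)
  qed
  then have "\<exists>!x. T x = x"
    by (intro banach_fix_type[of "sqrt q"]) (use q in \<open>auto simp: dist_norm\<close>)
  then obtain x where "T x = x" by blast
  then show ?thesis using g by (auto simp: T_def)
qed

lemma norm_vec_le_of_component_le:
  fixes v :: "real ^ 'n::finite"
  assumes "\<And>i. \<bar>v $ i\<bar> \<le> c i"
  shows "norm v \<le> (\<Sum>i\<in>UNIV. c i)"
  using norm_le_l1_cart[of v] sum_mono[of UNIV "\<lambda>i. \<bar>v $ i\<bar>" c] assms by auto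

lemma unique_nash_equilibrium:
  fixes f :: "'n::finite \<Rightarrow> real ^ 'n \<Rightarrow> real"
  assumes C1: "\<And>i. C_k 1 (f i)"
    and lip: "\<And>i. (l i)-lipschitz_on UNIV (partial i (f i))"
    and m: "m > 0"
    and mono: "\<And>x z. (x - z) \<bullet> (pseudo_gradient f x - pseudo_gradient f z) \<ge> m * (norm (x - z))\<^sup>2"
  shows "\<exists>xstar. pseudo_gradient f xstar = 0 \<and> nash_equilibrium f xstar \<and> (\<forall>x. nash_equilibrium f x \<longrightarrow> x = xstar)"
proof -
  have "norm (pseudo_gradient f x - pseudo_gradient f z) \<le> (\<Sum>i\<in>UNIV. l i) * norm (x - z)" for x z
    unfolding sum_distrib_right
    by (rule norm_vec_le_of_component_le)
       (use lipschitz_on_normD[OF lip, of x z] in \<open>auto simp: pseudo_gradient_def\<close>)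
  then obtain xstar where zero: "pseudo_gradient f xstar = 0"
    using strongly_monotone_lipschitz_has_zero[OF m mono] by blast
  have "(x - z) \<bullet> (pseudo_gradient f x - pseudo_gradient f z) \<ge> 0" for x z
    by (rule order_trans[OF _ mono]) (use m in simp)
  then have "nash_equilibrium f xstar"
    using zero by (intro pseudo_gradient_zero_imp_nash C1)
  moreover have "x = xstar" if "nash_equilibrium f x" for x
    using mono[of x xstar] nash_imp_pseudo_gradient_zero[OF C1 that] zero m
    by (auto simp: mult_le_0_iff)
  ultimately show ?thesis using zero by blast
qed

section \<open>Dissipation of the equilibrium-seeking dynamics\<close>

text \<open>
  The minimum over the unit sphere is attained and positive, and homogeneity extends the bound to all vectors.
\<close>

lemma homogeneous_form_coercive:
  fixes q :: "'a::euclidean_space \<Rightarrow> real"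
  assumes cont: "continuous_on UNIV q"
    and hom: "\<And>c e. q (c *\<^sub>R e) = c\<^sup>2 * q e"
    and pos: "\<And>e. e \<noteq> 0 \<Longrightarrow> q e > 0"
  shows "\<exists>\<kappa>>0. \<forall>e. q e \<ge> \<kappa> * (norm e)\<^sup>2"
proof -
  have "\<exists>u\<in>sphere (0::'a) 1. \<forall>e\<in>sphere 0 1. q u \<le> q e"
    by (rule continuous_attains_inf) (auto intro: continuous_on_subset[OF cont])
  then obtain u where u: "norm u = 1" "\<And>e. norm e = 1 \<Longrightarrow> q u \<le> q e" by auto
  have "q e \<ge> q u * (norm e)\<^sup>2" for e
  proof (cases "e = 0")
    case False
    have "q e = q (norm e *\<^sub>R (e /\<^sub>R norm e))" using False by simp
    also have "\<dots> = (norm e)\<^sup>2 * q (e /\<^sub>R norm e)" by (rule hom)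
    also have "\<dots> \<ge> (norm e)\<^sup>2 * q u" using False by (intro mult_left_mono u) auto
    finally show ?thesis by (simp add: mult.commute)
  qed (use hom[of 0 0] in simp)
  moreover have "q u > 0" using u by (intro pos) auto
  ultimately show ?thesis by blast
qed

text \<open>
  Symmetry of the weights allows averaging the double sum with the one in which the indices are exchanged.
\<close>

lemma laplacian_form:
  fixes a :: "'n::finite \<Rightarrow> 'n \<Rightarrow> real"
  assumes "\<And>i j. a i j = a j i"
  shows "(\<Sum>i\<in>UNIV. e i * (\<Sum>k\<in>UNIV. a i k * (e i - e k))) = (\<Sum>i\<in>UNIV. \<Sum>k\<in>UNIV. a i k * (e i - e k)\<^sup>2) / 2"
proof -
  let ?S = "\<Sum>i\<in>UNIV. \<Sum>k\<in>UNIV. a i k * (e i * (e i - e k))"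
  have "?S = (\<Sum>i\<in>UNIV. \<Sum>k\<in>UNIV. a i k * (e k * (e k - e i)))"
    by (subst sum.swap) (simp add: assms)
  then have "2 * ?S = (\<Sum>i\<in>UNIV. \<Sum>k\<in>UNIV. a i k * (e i * (e i - e k)) + a i k * (e k * (e k - e i)))"
    by (simp add: sum.distrib)
  also have "\<dots> = (\<Sum>i\<in>UNIV. \<Sum>k\<in>UNIV. a i k * (e i - e k)\<^sup>2)"
    by (intro sum.cong refl) (simp add: algebra_simps power2_eq_square)
  finally show ?thesis by (simp add: sum_distrib_left mult_ac)
qed

text \<open>
  The form is a sum of nonnegative squares. If it vanished, the values \<open>e i\<close> would agree along every edge, hence
  everywhere by connectedness, and would be zero at a neighbour of \<open>j\<close>. Such a neighbour exists because there is a
  second player.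
\<close>

lemma grounded_laplacian_positive:
  fixes a :: "'n::finite \<Rightarrow> 'n \<Rightarrow> real"
  assumes adj: "adjacency_matrix E a" and undir: "undirected_graph E a" and conn: "connected_graph E"
    and card: "CARD('n) \<ge> 2" and e: "e \<noteq> (\<lambda>_. 0)"
  shows "(\<Sum>i\<in>UNIV. e i * ((\<Sum>k\<in>UNIV. a i k * (e i - e k)) + a i j * e i)) > 0"
proof -
  have a0: "a i k \<ge> 0" for i k using adj unfolding adjacency_matrix_def by (metis less_eq_real_def)
  have aE: "(k, i) \<in> E \<Longrightarrow> a i k > 0" for i k using adj unfolding adjacency_matrix_def by blast
  have eq: "(\<Sum>i\<in>UNIV. e i * ((\<Sum>k\<in>UNIV. a i k * (e i - e k)) + a i j * e i))
     = (\<Sum>i\<in>UNIV. \<Sum>k\<in>UNIV. a i k * (e i - e k)\<^sup>2) / 2 + (\<Sum>i\<in>UNIV. a i j * (e i)\<^sup>2)"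
    using laplacian_form[of a e] undir
    by (simp add: undirected_graph_def distrib_left sum.distrib power2_eq_square mult_ac)
  have n1: "(\<Sum>i\<in>UNIV. \<Sum>k\<in>UNIV. a i k * (e i - e k)\<^sup>2) \<ge> 0" and n2: "(\<Sum>i\<in>UNIV. a i j * (e i)\<^sup>2) \<ge> 0"
    by (auto intro!: sum_nonneg mult_nonneg_nonneg a0)
  have "\<not> ((\<Sum>i\<in>UNIV. \<Sum>k\<in>UNIV. a i k * (e i - e k)\<^sup>2) = 0 \<and> (\<Sum>i\<in>UNIV. a i j * (e i)\<^sup>2) = 0)"
  proof
    assume z: "(\<Sum>i\<in>UNIV. \<Sum>k\<in>UNIV. a i k * (e i - e k)\<^sup>2) = 0 \<and> (\<Sum>i\<in>UNIV. a i j * (e i)\<^sup>2) = 0"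
    then have edge_term: "a i k * (e i - e k)\<^sup>2 = 0" for i k
      by (simp add: sum_nonneg_eq_0_iff sum_nonneg a0)
    then have edge: "e i = e k" if "(k, i) \<in> E" for i k using aE[OF that] edge_term[of i k] by simp
    have path: "e i = e k" if "(k, i) \<in> E\<^sup>+" for i k
      using that by induction (use edge in force)+
    have const: "e i = e k" for i k
      using path conn unfolding connected_graph_def by metis
    have "\<exists>i. i \<noteq> j"
    proof (rule ccontr)
      assume "\<nexists>i. i \<noteq> j"
      then have "(UNIV :: 'n set) = {j}" by auto
      then have "CARD('n) = card {j}" by simp
      then show False using card by simp
    qed
    then obtain i where "i \<noteq> j" by blast
    then have "(j, i) \<in> E\<^sup>+" using conn by (simp add: connected_graph_def)
    then obtain k where "(j, k) \<in> E" by (meson converse_tranclE)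
    then have "a k j > 0" by (rule aE)
    moreover have "a k j * (e k)\<^sup>2 = 0" using z by (simp add: sum_nonneg_eq_0_iff a0)
    ultimately have "e k = 0" by simp
    then show False using const e by (metis)
  qed
  then show ?thesis unfolding eq using n1 n2 by linarith
qed

text \<open>
  For each fixed \<open>j\<close> the column \<open>(e\<^sub>i\<^sub>j)\<^sub>i\<close> is governed by the Laplacian grounded at the neighbours of \<open>j\<close>; treating the
  columns together gives one constant for all of them.
\<close>

lemma estimation_form_coercive:
  fixes a :: "'n::finite \<Rightarrow> 'n \<Rightarrow> real"
  assumes adj: "adjacency_matrix E a" and undir: "undirected_graph E a" and conn: "connected_graph E"
    and card: "CARD('n) \<ge> 2"
  shows "\<exists>\<kappa>>0. \<forall>e :: real ^ 'n ^ 'n.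
    (\<Sum>i\<in>UNIV. \<Sum>j\<in>UNIV. e $ i $ j * ((\<Sum>k\<in>UNIV. a i k * (e $ i $ j - e $ k $ j)) + a i j * e $ i $ j))
      \<ge> \<kappa> * (norm e)\<^sup>2"
proof (rule homogeneous_form_coercive)
  show "continuous_on UNIV (\<lambda>e::real ^ 'n ^ 'n.
    \<Sum>i\<in>UNIV. \<Sum>j\<in>UNIV. e $ i $ j * ((\<Sum>k\<in>UNIV. a i k * (e $ i $ j - e $ k $ j)) + a i j * e $ i $ j))"
    by (intro continuous_intros)
  fix c and e :: "real ^ 'n ^ 'n"
  show "(\<Sum>i\<in>UNIV. \<Sum>j\<in>UNIV. (c *\<^sub>R e) $ i $ j * ((\<Sum>k\<in>UNIV. a i k * ((c *\<^sub>R e) $ i $ j - (c *\<^sub>R e) $ k $ j)) + a i j * (c *\<^sub>R e) $ i $ j))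
    = c\<^sup>2 * (\<Sum>i\<in>UNIV. \<Sum>j\<in>UNIV. e $ i $ j * ((\<Sum>k\<in>UNIV. a i k * (e $ i $ j - e $ k $ j)) + a i j * e $ i $ j))"
  proof -
    have pull: "(\<Sum>k\<in>UNIV. a i k * (c * e $ i $ j - c * e $ k $ j)) = c * (\<Sum>k\<in>UNIV. a i k * (e $ i $ j - e $ k $ j))" for i j
      unfolding sum_distrib_left by (intro sum.cong refl) (simp add: algebra_simps)
    have factor: "c * x * (c * s + b * (c * x)) = c\<^sup>2 * (x * (s + b * x))" for x s b :: real
      by (simp add: algebra_simps power2_eq_square)
    show ?thesis
      unfolding sum_distrib_left[of "c\<^sup>2"]
      by (intro sum.cong refl) (simp only: vector_scaleR_component real_scaleR_def pull factor)
  qed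
next
  fix e :: "real ^ 'n ^ 'n" assume "e \<noteq> 0"
  let ?q = "\<lambda>j. \<Sum>i\<in>UNIV. e $ i $ j * ((\<Sum>k\<in>UNIV. a i k * (e $ i $ j - e $ k $ j)) + a i j * e $ i $ j)"
  have pos: "?q j > 0" if "(\<lambda>i. e $ i $ j) \<noteq> (\<lambda>_. 0)" for j
    using grounded_laplacian_positive[OF adj undir conn card that, of j] .
  have nonneg: "?q j \<ge> 0" for j
  proof (cases "(\<lambda>i. e $ i $ j) = (\<lambda>_. 0)")
    case True
    then have "e $ i $ j = 0" for i by (rule fun_cong)
    then show ?thesis by simp
  qed (use pos in force)
  obtain i j where "e $ i $ j \<noteq> 0" using \<open>e \<noteq> 0\<close> by (auto simp: vec_eq_iff)
  then have "?q j > 0" by (intro pos) (auto dest: fun_cong)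
  then have "(\<Sum>j\<in>UNIV. ?q j) > 0" using nonneg by (rule sum_pos2[OF finite UNIV_I])
  then show "(\<Sum>i\<in>UNIV. \<Sum>j\<in>UNIV. e $ i $ j * ((\<Sum>k\<in>UNIV. a i k * (e $ i $ j - e $ k $ j)) + a i j * e $ i $ j)) > 0"
    by (subst sum.swap)
qed

text \<open>
  The left-hand side is the derivative, along the \<open>y\<close> and \<open>z\<close> equations, of half the sum of the
  squares \<open>(y\<^sub>i - x\<^sup>*\<^sub>i)\<^sup>2\<close> and \<open>w\<^sub>i\<^sub>j (z\<^sub>i\<^sub>j - y\<^sub>j)\<^sup>2\<close>. The inequality concerns vectors rather than solutions, so that it
  can be used for any solution on any time interval.
\<close>

definition seeking_dissipates ::
  "('n::finite \<Rightarrow> real ^ 'n \<Rightarrow> real) \<Rightarrow> ('n \<Rightarrow> 'n \<Rightarrow> real) \<Rightarrow> ('n \<Rightarrow> 'n \<Rightarrow> real) \<Rightarrow> ('n \<Rightarrow> 'n \<Rightarrow> real) \<Rightarrow>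
   real ^ 'n \<Rightarrow> real \<Rightarrow> bool" where
  "seeking_dissipates f a \<delta> w xstar c \<longleftrightarrow> (\<forall>y (z :: real ^ 'n ^ 'n).
    (\<Sum>i\<in>UNIV. (y $ i - xstar $ i) * (- partial i (f i) (z $ i))) +
    (\<Sum>i\<in>UNIV. \<Sum>j\<in>UNIV. w i j * (z $ i $ j - y $ j) *
       (- \<delta> i j * ((\<Sum>k\<in>UNIV. a i k * (z $ i $ j - z $ k $ j)) + a i j * (z $ i $ j - y $ j))
        - (- partial j (f j) (z $ j))))
    \<le> - c * ((norm (y - xstar))\<^sup>2 + (norm (\<chi> i. z $ i - y))\<^sup>2))"

text \<open>
  With the weights \<open>1 / \<delta>bar\<close> the consensus part of the derivative becomes \<open>\<delta>\<close> times the coercive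
  estimation form. Strong monotonicity yields \<open>- m \<parallel>y - x\<^sup>*\<parallel>\<^sup>2\<close>. The remaining terms come from evaluating the
  partial derivatives at the estimates, and from the drift of \<open>y\<close> in the error equations; by the Lipschitz condition
  they are at most \<open>K \<parallel>y - x\<^sup>*\<parallel> \<parallel>e\<parallel> + K \<parallel>e\<parallel>\<^sup>2\<close>. Young's inequality spends half of \<open>m\<close> on the mixed term, and a
  large \<open>\<delta>\<close> absorbs the rest.
\<close>

lemma seeking_dissipation:
  fixes f :: "'n::finite \<Rightarrow> real ^ 'n \<Rightarrow> real"
  assumes card: "CARD('n) \<ge> 2"
    and lip: "\<And>i. (l i)-lipschitz_on UNIV (partial i (f i))"
    and m: "m > 0"
    and mono: "\<And>x z. (x - z) \<bullet> (pseudo_gradient f x - pseudo_gradient f z) \<ge> m * (norm (x - z))\<^sup>2"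
    and adj: "adjacency_matrix E a" and undir: "undirected_graph E a" and conn: "connected_graph E"
    and dbar: "\<And>i j. \<delta>bar i j > 0"
    and zero: "pseudo_gradient f xstar = 0"
  shows "\<exists>\<delta>star>0. \<forall>\<delta>>\<delta>star.
    \<exists>c>0. seeking_dissipates f a (\<lambda>i j. \<delta> * \<delta>bar i j) (\<lambda>i j. 1 / \<delta>bar i j) xstar c"
proof -
  obtain \<kappa> where \<kappa>: "\<kappa> > 0" and coercive: "\<And>e :: real ^ 'n ^ 'n.
      (\<Sum>i\<in>UNIV. \<Sum>j\<in>UNIV. e $ i $ j * ((\<Sum>k\<in>UNIV. a i k * (e $ i $ j - e $ k $ j)) + a i j * e $ i $ j))
      \<ge> \<kappa> * (norm e)\<^sup>2"
    using estimation_form_coercive[OF adj undir conn card] by blast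
  define \<Lambda> where "\<Lambda> = (\<Sum>i\<in>UNIV. l i)"
  have l0: "l i \<ge> 0" for i using lip lipschitz_on_nonneg by blast
  have l\<Lambda>: "l i \<le> \<Lambda>" for i unfolding \<Lambda>_def by (rule member_le_sum) (auto simp: l0)
  have \<Lambda>: "\<Lambda> \<ge> 0" using l0[of undefined] l\<Lambda>[of undefined] by linarith
  have lip': "\<bar>partial i (f i) u - partial i (f i) w\<bar> \<le> \<Lambda> * norm (u - w)" for i u w
    using lipschitz_on_normD[OF lip[of i], of u w] mult_right_mono[OF l\<Lambda>[of i], of "norm (u - w)"] by simp
  define D where "D = (\<Sum>i\<in>UNIV. \<Sum>j\<in>UNIV. 1 / \<delta>bar i j)"
  define n where "n = real CARD('n)"
  define K where "K = n * \<Lambda> + D * \<Lambda>"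
  have D0: "D \<ge> 0" unfolding D_def by (intro sum_nonneg) (use dbar in \<open>auto simp: less_imp_le\<close>)
  have K: "K \<ge> 0" using \<Lambda> D0 by (simp add: K_def n_def)
  define \<delta>star where "\<delta>star = (K + K\<^sup>2 / (2 * m) + 1) / \<kappa>"
  have dstar: "\<delta>star > 0" unfolding \<delta>star_def using K \<kappa> m by (intro divide_pos_pos add_nonneg_pos add_nonneg_nonneg) auto
  show ?thesis
  proof (rule exI[of _ \<delta>star], intro conjI allI impI dstar)
    fix \<delta> assume \<delta>: "\<delta> > \<delta>star"
    define c where "c = min (m / 2) 1"
    have c: "c > 0" using m by (simp add: c_def)
    \<comment> \<open>the part of the consensus contraction that remains after all cross terms are paid for\<close>
    have gap: "\<delta> * \<kappa> - K - K\<^sup>2 / (2 * m) \<ge> 1"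
      using \<delta> \<kappa> unfolding \<delta>star_def by (simp add: divide_less_eq)
    show "\<exists>c>0. seeking_dissipates f a (\<lambda>i j. \<delta> * \<delta>bar i j) (\<lambda>i j. 1 / \<delta>bar i j) xstar c"
      unfolding seeking_dissipates_def
    proof (rule exI[of _ c], intro conjI allI c)
      fix y :: "real ^ 'n" and z :: "real ^ 'n ^ 'n"
      define e where "e = (\<chi> i. z $ i - y)"
      have e: "e $ i $ j = z $ i $ j - y $ j" for i j by (simp add: e_def)
      let ?Y = "norm (y - xstar)" and ?W = "norm e"
      have row: "norm (z $ i - y) \<le> ?W" for i using Finite_Cartesian_Product.norm_nth_le[of e i] by (simp add: e_def)
      have comp: "\<bar>e $ i $ j\<bar> \<le> ?W" for i j
        using Finite_Cartesian_Product.norm_nth_le[of "e $ i" j] Finite_Cartesian_Product.norm_nth_le[of e i] by simp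
      have err: "\<bar>partial i (f i) y - partial i (f i) (z $ i)\<bar> \<le> \<Lambda> * ?W" for i
        using lip'[of i "z $ i" y] mult_left_mono[OF row[of i] \<Lambda>] by (simp add: abs_minus_commute)
      have zero_i: "partial i (f i) xstar = 0" for i using zero by (simp add: pseudo_gradient_def vec_eq_iff)
      have rate: "\<bar>partial i (f i) (z $ i)\<bar> \<le> \<Lambda> * ?Y + \<Lambda> * ?W" for i
        using lip'[of i y xstar] zero_i[of i] err[of i] by simp
      have 1: "(\<Sum>i\<in>UNIV. (y $ i - xstar $ i) * (- partial i (f i) (z $ i))) \<le> - m * ?Y\<^sup>2 + n * \<Lambda> * ?Y * ?W"
      proof -
        have "(y $ i - xstar $ i) * (partial i (f i) y - partial i (f i) (z $ i)) \<le> ?Y * (\<Lambda> * ?W)" for i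
        proof -
          have "\<bar>y $ i - xstar $ i\<bar> \<le> ?Y" using Finite_Cartesian_Product.norm_nth_le[of "y - xstar" i] by simp
          then have "\<bar>(y $ i - xstar $ i) * (partial i (f i) y - partial i (f i) (z $ i))\<bar> \<le> ?Y * (\<Lambda> * ?W)"
            unfolding abs_mult using err[of i] by (intro mult_mono) auto
          then show ?thesis by linarith
        qed
        then have "(\<Sum>i\<in>UNIV. (y $ i - xstar $ i) * (partial i (f i) y - partial i (f i) (z $ i)))
          \<le> n * (?Y * (\<Lambda> * ?W))" unfolding n_def by (intro sum_bounded_above) simp
        moreover have "(\<Sum>i\<in>UNIV. (y $ i - xstar $ i) * partial i (f i) y) \<ge> m * ?Y\<^sup>2"
          using mono[of y xstar] unfolding zero by (simp add: inner_vec_def pseudo_gradient_def)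
        ultimately show ?thesis by (simp add: right_diff_distrib sum_subtractf sum_negf mult_ac)
      qed
      have 2: "(\<Sum>i\<in>UNIV. \<Sum>j\<in>UNIV. e $ i $ j / \<delta>bar i j * partial j (f j) (z $ j))
         \<le> D * \<Lambda> * ?Y * ?W + D * \<Lambda> * ?W\<^sup>2"
      proof -
        have "e $ i $ j / \<delta>bar i j * partial j (f j) (z $ j) \<le> 1 / \<delta>bar i j * (?W * (\<Lambda> * ?Y + \<Lambda> * ?W))" for i j
        proof -
          have "\<bar>e $ i $ j * partial j (f j) (z $ j)\<bar> \<le> ?W * (\<Lambda> * ?Y + \<Lambda> * ?W)"
            unfolding abs_mult by (intro mult_mono comp rate) auto
          then have "e $ i $ j * partial j (f j) (z $ j) \<le> ?W * (\<Lambda> * ?Y + \<Lambda> * ?W)" by linarith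
          then show ?thesis using dbar[of i j] by (simp add: divide_right_mono)
        qed
        then have "(\<Sum>i\<in>UNIV. \<Sum>j\<in>UNIV. e $ i $ j / \<delta>bar i j * partial j (f j) (z $ j))
          \<le> (\<Sum>i\<in>UNIV. \<Sum>j\<in>UNIV. 1 / \<delta>bar i j * (?W * (\<Lambda> * ?Y + \<Lambda> * ?W)))"
          by (intro sum_mono)
        also have "\<dots> = D * (?W * (\<Lambda> * ?Y + \<Lambda> * ?W))"
          unfolding D_def by (simp add: sum_distrib_right)
        finally show ?thesis by (simp add: algebra_simps power2_eq_square)
      qed
      have 3: "(\<Sum>i\<in>UNIV. \<Sum>j\<in>UNIV. 1 / \<delta>bar i j * (z $ i $ j - y $ j) *
           (- (\<delta> * \<delta>bar i j) * ((\<Sum>k\<in>UNIV. a i k * (z $ i $ j - z $ k $ j)) + a i j * (z $ i $ j - y $ j))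
            - (- partial j (f j) (z $ j))))
        = (\<Sum>i\<in>UNIV. \<Sum>j\<in>UNIV. e $ i $ j / \<delta>bar i j * partial j (f j) (z $ j)) -
          \<delta> * (\<Sum>i\<in>UNIV. \<Sum>j\<in>UNIV. e $ i $ j * ((\<Sum>k\<in>UNIV. a i k * (e $ i $ j - e $ k $ j)) + a i j * e $ i $ j))"
      proof -
        have pt: "1 / \<delta>bar i j * (z $ i $ j - y $ j) *
            (- (\<delta> * \<delta>bar i j) * ((\<Sum>k\<in>UNIV. a i k * (z $ i $ j - z $ k $ j)) + a i j * (z $ i $ j - y $ j))
            - (- partial j (f j) (z $ j)))
          = e $ i $ j / \<delta>bar i j * partial j (f j) (z $ j) -
            \<delta> * (e $ i $ j * ((\<Sum>k\<in>UNIV. a i k * (e $ i $ j - e $ k $ j)) + a i j * e $ i $ j))" for i j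
        proof -
          have "(1 / b * d) * (- (\<delta> * b) * S - (- p)) = d / b * p - \<delta> * (d * S)" if "b \<noteq> 0" for d b S p :: real
            using that by (simp add: field_simps)
          from this[of "\<delta>bar i j"] show ?thesis using dbar[of i j] by (simp add: e)
        qed
        show ?thesis unfolding pt by (simp add: sum_subtractf sum_distrib_left)
      qed
      \<comment> \<open>Young's inequality, by completing the square\<close>
      have "K * ?Y * ?W \<le> m / 2 * ?Y\<^sup>2 + K\<^sup>2 / (2 * m) * ?W\<^sup>2"
      proof -
        have "0 \<le> (m * ?Y - K * ?W)\<^sup>2 / (2 * m)" using m by simp
        also have "\<dots> = m / 2 * ?Y\<^sup>2 + K\<^sup>2 / (2 * m) * ?W\<^sup>2 - K * ?Y * ?W"
          using m by (simp add: field_simps power2_eq_square)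
        finally show ?thesis by simp
      qed
      moreover have "n * \<Lambda> * ?Y * ?W + D * \<Lambda> * ?Y * ?W = K * ?Y * ?W" by (simp add: K_def algebra_simps)
      moreover have "D * \<Lambda> * ?W\<^sup>2 \<le> K * ?W\<^sup>2" using \<Lambda> by (intro mult_right_mono) (auto simp: K_def n_def)
      moreover have "\<delta> * (\<kappa> * ?W\<^sup>2) \<le> \<delta> * (\<Sum>i\<in>UNIV. \<Sum>j\<in>UNIV. e $ i $ j * ((\<Sum>k\<in>UNIV. a i k * (e $ i $ j - e $ k $ j)) + a i j * e $ i $ j))"
        using coercive \<delta> dstar by (intro mult_left_mono) auto
      moreover have "c * ?Y\<^sup>2 \<le> m / 2 * ?Y\<^sup>2" by (intro mult_right_mono) (auto simp: c_def)
      moreover have "c * ?W\<^sup>2 \<le> (\<delta> * \<kappa> - K - K\<^sup>2 / (2 * m)) * ?W\<^sup>2"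
        using gap by (intro mult_right_mono) (auto simp: c_def)
      moreover have "(\<delta> * \<kappa> - K - K\<^sup>2 / (2 * m)) * ?W\<^sup>2 = \<delta> * (\<kappa> * ?W\<^sup>2) - K * ?W\<^sup>2 - K\<^sup>2 / (2 * m) * ?W\<^sup>2"
        by (simp add: algebra_simps)
      moreover have "- c * (?Y\<^sup>2 + ?W\<^sup>2) = - (c * ?Y\<^sup>2) - c * ?W\<^sup>2" by (simp add: algebra_simps)
      moreover have "m * ?Y\<^sup>2 = m / 2 * ?Y\<^sup>2 + m / 2 * ?Y\<^sup>2" by (simp add: field_simps)
      ultimately have "(\<Sum>i\<in>UNIV. (y $ i - xstar $ i) * (- partial i (f i) (z $ i))) +
        ((\<Sum>i\<in>UNIV. \<Sum>j\<in>UNIV. e $ i $ j / \<delta>bar i j * partial j (f j) (z $ j)) -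
          \<delta> * (\<Sum>i\<in>UNIV. \<Sum>j\<in>UNIV. e $ i $ j * ((\<Sum>k\<in>UNIV. a i k * (e $ i $ j - e $ k $ j)) + a i j * e $ i $ j)))
        \<le> - c * (?Y\<^sup>2 + ?W\<^sup>2)"
        using 1 2 by linarith
      then show "(\<Sum>i\<in>UNIV. (y $ i - xstar $ i) * (- partial i (f i) (z $ i))) +
        (\<Sum>i\<in>UNIV. \<Sum>j\<in>UNIV. 1 / \<delta>bar i j * (z $ i $ j - y $ j) *
         (- (\<delta> * \<delta>bar i j) * ((\<Sum>k\<in>UNIV. a i k * (z $ i $ j - z $ k $ j)) + a i j * (z $ i $ j - y $ j))
          - (- partial j (f j) (z $ j))))
        \<le> - c * ((norm (y - xstar))\<^sup>2 + (norm (\<chi> i. z $ i - y))\<^sup>2)"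
        unfolding 3 e_def[symmetric] .
    qed
  qed
qed

section \<open>Boundedness of images\<close>

lemma bounded_real_comp_arith:
  fixes p q :: "'a \<Rightarrow> real"
  assumes p: "bounded (p ` A)" and q: "bounded (q ` A)"
  shows "bounded ((\<lambda>s. p s + q s) ` A)" "bounded ((\<lambda>s. p s - q s) ` A)" "bounded ((\<lambda>s. p s * q s) ` A)"
proof -
  obtain P Q where P: "\<And>s. s \<in> A \<Longrightarrow> \<bar>p s\<bar> \<le> P" and Q: "\<And>s. s \<in> A \<Longrightarrow> \<bar>q s\<bar> \<le> Q"
    using p q by (auto simp: bounded_iff)
  show "bounded ((\<lambda>s. p s + q s) ` A)"
    unfolding bounded_iff by (rule exI[of _ "P + Q"]) (use P Q in fastforce)
  show "bounded ((\<lambda>s. p s - q s) ` A)"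
    unfolding bounded_iff by (rule exI[of _ "P + Q"]) (use P Q in fastforce)
  have "\<bar>p s * q s\<bar> \<le> P * Q" if "s \<in> A" for s
    unfolding abs_mult by (intro mult_mono P Q that order_trans[OF _ P[OF that]]) auto
  then show "bounded ((\<lambda>s. p s * q s) ` A)"
    unfolding bounded_iff by auto
qed

lemma bounded_const_image: "bounded ((\<lambda>_. c) ` A)"
  by (rule bounded_subset[of "{c}"]) auto

text \<open>
  A bounded set has compact closure, on which a continuous function is bounded.
\<close>

lemma bounded_continuous_comp:
  fixes g :: "'b::heine_borel \<Rightarrow> 'c::metric_space"
  assumes g: "continuous_on UNIV g" and q: "bounded (q ` A)"
  shows "bounded ((\<lambda>s. g (q s)) ` A)"
proof (rule bounded_subset)
  have "compact (closure (q ` A))" using q by (simp add: compact_closure)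
  then show "bounded (g ` closure (q ` A))"
    by (intro compact_imp_bounded compact_continuous_image continuous_on_subset[OF g]) auto
  show "(\<lambda>s. g (q s)) ` A \<subseteq> g ` closure (q ` A)" using closure_subset by blast
qed

lemma bounded_vec_image:
  fixes q :: "'b \<Rightarrow> 'c::real_normed_vector ^ 'm::finite"
  assumes "\<And>i. bounded ((\<lambda>s. q s $ i) ` A)"
  shows "bounded (q ` A)"
proof -
  have "\<forall>i. \<exists>B. \<forall>s\<in>A. norm (q s $ i) \<le> B"
    using assms by (simp add: bounded_iff)
  then obtain B where B: "\<And>i s. s \<in> A \<Longrightarrow> norm (q s $ i) \<le> B i"
    by metis
  have "norm (q s) \<le> (\<Sum>i\<in>UNIV. B i)" if "s \<in> A" for s
  proof -
    have "norm (q s) \<le> (\<Sum>i\<in>UNIV. norm (q s $ i))" unfolding norm_vec_def by (rule L2_set_le_sum) simp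
    also have "\<dots> \<le> (\<Sum>i\<in>UNIV. B i)" by (intro sum_mono B that)
    finally show ?thesis .
  qed
  then show ?thesis unfolding bounded_iff by blast
qed

lemma bounded_of_square_le:
  fixes q :: "'a \<Rightarrow> real"
  assumes "\<And>s. s \<in> A \<Longrightarrow> (q s)\<^sup>2 \<le> B"
  shows "bounded (q ` A)"
  unfolding bounded_iff
proof (rule exI[of _ "B + 1"], clarify)
  fix s assume "s \<in> A"
  have "0 \<le> (\<bar>q s\<bar> - 1)\<^sup>2" by simp
  then have "2 * \<bar>q s\<bar> \<le> (q s)\<^sup>2 + 1" by (simp add: power2_eq_square algebra_simps)
  then show "norm (q s) \<le> B + 1" using assms[OF \<open>s \<in> A\<close>] abs_ge_zero[of "q s"] by simp
qed

lemma bounded_of_offset_square_le: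
  fixes q :: "'a \<Rightarrow> real"
  assumes "\<And>s. s \<in> A \<Longrightarrow> (p - q s)\<^sup>2 \<le> B"
  shows "bounded (q ` A)"
proof -
  have "bounded ((\<lambda>s. p - q s) ` A)" using assms by (rule bounded_of_square_le)
  then have "bounded ((\<lambda>s. p - (p - q s)) ` A)" by (rule bounded_real_comp_arith(2)[OF bounded_const_image])
  moreover have "(\<lambda>s. p - (p - q s)) = q" by auto
  ultimately show ?thesis by (simp only:)
qed

lemma bounded_imp_upper:
  fixes q :: "'a \<Rightarrow> real"
  assumes "bounded (q ` A)"
  obtains B where "\<And>s. s \<in> A \<Longrightarrow> \<bar>q s\<bar> \<le> B"
  using assms by (auto simp: bounded_iff)

section \<open>Orbits of the closed loop\<close>

text \<open>
  The closed loop for one fixed matrix \<open>\<delta>\<close> of gains that is large enough for the seeking dynamics to be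
  dissipative. The weights \<open>w\<close> and the rate \<open>c\<close> are those of the dissipation inequality.
\<close>

locale closed_loop =
  fixes f :: "'n::finite \<Rightarrow> real ^ 'n \<Rightarrow> real"
    and \<phi>1 :: "'n \<Rightarrow> real \<Rightarrow> real"
    and \<phi>2 :: "'n \<Rightarrow> real \<times> real \<Rightarrow> real"
    and b1 b2 \<theta>1 \<theta>2 l :: "'n \<Rightarrow> real"
    and a \<delta> w :: "'n \<Rightarrow> 'n \<Rightarrow> real"
    and c :: real and xstar :: "real ^ 'n"
  assumes b1_nonzero: "b1 i \<noteq> 0" and b2_nonzero: "b2 i \<noteq> 0"
    and \<phi>1_smooth: "smooth (\<phi>1 i)" and \<phi>2_smooth: "smooth (\<phi>2 i)"
    and lipschitz: "(l i)-lipschitz_on UNIV (partial i (f i))"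
    and zero: "partial i (f i) xstar = 0"
    and w_pos: "w i j > 0" and c_pos: "c > 0"
    and dissipation: "seeking_dissipates f a \<delta> w xstar c"
begin

definition x_rate :: "'n \<Rightarrow> 'n state \<Rightarrow> real" where
  "x_rate i s = b1 i * st_v s $ i + \<phi>1 i (st_x s $ i) * \<theta>1 i"

definition v_rate :: "'n \<Rightarrow> 'n state \<Rightarrow> real" where
  "v_rate i s = b2 i * control f \<phi>1 \<phi>2 i s + \<phi>2 i (st_x s $ i, st_v s $ i) * \<theta>2 i"

definition z_rate :: "'n \<Rightarrow> 'n \<Rightarrow> 'n state \<Rightarrow> real" where
  "z_rate i j s = - \<delta> i j * ((\<Sum>k\<in>UNIV. a i k * (st_z s $ i $ j - st_z s $ k $ j))
                     + a i j * (st_z s $ i $ j - st_y s $ j))"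

definition tracking_error :: "'n \<Rightarrow> 'n state \<Rightarrow> real" where
  "tracking_error i s = st_x s $ i - st_y s $ i"

definition k1_rate :: "'n \<Rightarrow> 'n state \<Rightarrow> real" where
  "k1_rate i s = tracking_error i s * eta1 \<phi>1 i s"

definition k2_rate :: "'n \<Rightarrow> 'n state \<Rightarrow> real" where
  "k2_rate i s = beta \<phi>1 i s * eta2 f \<phi>1 \<phi>2 i s"

text \<open>
  Solutions on an arbitrary set of times. The a priori bounds are needed on compact intervals, before any
  global solution is known to exist.
\<close>

definition solves_on :: "real set \<Rightarrow> (real \<Rightarrow> 'n state) \<Rightarrow> bool" where
  "solves_on I S \<longleftrightarrow> (\<forall>t\<in>I. \<forall>i.
      ((\<lambda>\<tau>. st_x (S \<tau>) $ i) has_real_derivative x_rate i (S t)) (at t within I) \<and>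
      ((\<lambda>\<tau>. st_v (S \<tau>) $ i) has_real_derivative v_rate i (S t)) (at t within I) \<and>
      ((\<lambda>\<tau>. st_y (S \<tau>) $ i) has_real_derivative y_rate f i (S t)) (at t within I) \<and>
      (\<forall>j. ((\<lambda>\<tau>. st_z (S \<tau>) $ i $ j) has_real_derivative z_rate i j (S t)) (at t within I)) \<and>
      ((\<lambda>\<tau>. st_k1 (S \<tau>) $ i) has_real_derivative k1_rate i (S t)) (at t within I) \<and>
      ((\<lambda>\<tau>. st_th1hat (S \<tau>) $ i) has_real_derivative
         \<phi>1 i (st_x (S t) $ i) * tracking_error i (S t)) (at t within I) \<and>
      ((\<lambda>\<tau>. st_k2 (S \<tau>) $ i) has_real_derivative k2_rate i (S t)) (at t within I) \<and>
      ((\<lambda>\<tau>. st_th2bar (S \<tau>) $ i) has_real_derivative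
         beta \<phi>1 i (S t) * \<phi>2 i (st_x (S t) $ i, st_v (S t) $ i)) (at t within I) \<and>
      ((\<lambda>\<tau>. st_th1bar (S \<tau>) $ i) has_real_derivative
         beta \<phi>1 i (S t) * Psi1 \<phi>1 i (S t)) (at t within I) \<and>
      ((\<lambda>\<tau>. st_b1bar (S \<tau>) $ i) has_real_derivative
         beta \<phi>1 i (S t) * Psi3 \<phi>1 i (S t)) (at t within I))"

lemma closed_loop_solution_iff:
  "closed_loop_solution f a \<phi>1 \<phi>2 b1 b2 \<theta>1 \<theta>2 \<delta> S \<longleftrightarrow> solves_on {0..} S"
  unfolding closed_loop_solution_def solves_on_def x_rate_def v_rate_def z_rate_def
    k1_rate_def k2_rate_def tracking_error_def Ball_def atLeast_iff by (rule refl)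

lemma solves_on_subset: "solves_on I S \<Longrightarrow> J \<subseteq> I \<Longrightarrow> solves_on J S"
  unfolding solves_on_def by (meson DERIV_subset subsetD)

lemma solves_on_deriv:
  assumes "solves_on I S" "t \<in> I"
  shows "((\<lambda>\<tau>. st_x (S \<tau>) $ i) has_real_derivative x_rate i (S t)) (at t within I)"
    "((\<lambda>\<tau>. st_v (S \<tau>) $ i) has_real_derivative v_rate i (S t)) (at t within I)"
    "((\<lambda>\<tau>. st_y (S \<tau>) $ i) has_real_derivative y_rate f i (S t)) (at t within I)"
    "((\<lambda>\<tau>. st_z (S \<tau>) $ i $ j) has_real_derivative z_rate i j (S t)) (at t within I)"
    "((\<lambda>\<tau>. st_k1 (S \<tau>) $ i) has_real_derivative k1_rate i (S t)) (at t within I)"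
    "((\<lambda>\<tau>. st_th1hat (S \<tau>) $ i) has_real_derivative
         \<phi>1 i (st_x (S t) $ i) * tracking_error i (S t)) (at t within I)"
    "((\<lambda>\<tau>. st_k2 (S \<tau>) $ i) has_real_derivative k2_rate i (S t)) (at t within I)"
    "((\<lambda>\<tau>. st_th2bar (S \<tau>) $ i) has_real_derivative
         beta \<phi>1 i (S t) * \<phi>2 i (st_x (S t) $ i, st_v (S t) $ i)) (at t within I)"
    "((\<lambda>\<tau>. st_th1bar (S \<tau>) $ i) has_real_derivative
         beta \<phi>1 i (S t) * Psi1 \<phi>1 i (S t)) (at t within I)"
    "((\<lambda>\<tau>. st_b1bar (S \<tau>) $ i) has_real_derivative
         beta \<phi>1 i (S t) * Psi3 \<phi>1 i (S t)) (at t within I)"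
  using assms unfolding solves_on_def by blast+

text \<open>
  The derivative of a function of the state along solutions, expressed as a function of the state again (a Lie
  derivative).
\<close>

definition rate_along_loop :: "('n state \<Rightarrow> real) \<Rightarrow> ('n state \<Rightarrow> real) \<Rightarrow> bool" where
  "rate_along_loop Q Q' \<longleftrightarrow> (\<forall>I S t. solves_on I S \<longrightarrow> t \<in> I \<longrightarrow>
     ((\<lambda>\<tau>. Q (S \<tau>)) has_real_derivative Q' (S t)) (at t within I))"

lemma rate_along_loopD:
  "rate_along_loop Q Q' \<Longrightarrow> solves_on I S \<Longrightarrow> t \<in> I \<Longrightarrow>
    ((\<lambda>\<tau>. Q (S \<tau>)) has_real_derivative Q' (S t)) (at t within I)"
  unfolding rate_along_loop_def by blast

text \<open>
  A bound on this set is a bound on all solutions from \<open>s0\<close> that is uniform in the length of the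
  time interval on which they exist.
\<close>

definition reachable :: "'n state \<Rightarrow> 'n state set" where
  "reachable s0 = {S T | S T. T \<ge> 0 \<and> solves_on {0..T} S \<and> S 0 = s0}"

lemma solution_reachable:
  assumes "solves_on I S" "{0..t} \<subseteq> I" "t \<ge> 0"
  shows "S t \<in> reachable (S 0)"
  using assms solves_on_subset unfolding reachable_def by blast

lemma nonincreasing_on_reachable:
  assumes "rate_along_loop Q Q'" "\<And>s. Q' s \<le> 0" "s \<in> reachable s0"
  shows "Q s \<le> Q s0"
proof -
  obtain S T where S: "T \<ge> 0" "solves_on {0..T} S" "S 0 = s0" "s = S T"
    using assms(3) by (auto simp: reachable_def)
  have "Q (S T) - Q (S 0) \<le> - 0 * (T - 0)"
    by (rule decrease_at_rate[where Q' = "\<lambda>t. Q' (S t)"])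
       (use assms(1,2) S in \<open>auto simp: rate_along_loop_def\<close>)
  then show ?thesis using S by simp
qed

text \<open>
  The hypothesis at all reachable states covers all earlier times of a solution, since these are reachable as
  well.
\<close>

lemma gain_bounded_on_reachable:
  assumes \<kappa>: "rate_along_loop \<kappa> \<kappa>'" and b: "b \<noteq> 0"
    and low: "\<And>s. s \<in> reachable s0 \<Longrightarrow> nussbaum_primitive b (\<kappa> s) \<ge> - C"
  shows "bounded (\<kappa> ` reachable s0)"
proof -
  obtain K where K: "\<forall>T\<ge>0. \<forall>k :: real \<Rightarrow> real. continuous_on {0..T} k \<longrightarrow> k 0 = \<kappa> s0 \<longrightarrow>
      (\<forall>t\<in>{0..T}. nussbaum_primitive b (k t) \<ge> - C) \<longrightarrow> \<bar>k T\<bar> \<le> K"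
    using nussbaum_gain_bounded[OF b] by (rule exE)
  have "\<bar>\<kappa> s\<bar> \<le> K" if s: "s \<in> reachable s0" for s
  proof -
    obtain S T where S: "T \<ge> 0" "solves_on {0..T} S" "S 0 = s0" "s = S T"
      using s by (auto simp: reachable_def)
    have "\<bar>\<kappa> (S T)\<bar> \<le> K"
    proof (rule K[rule_format, of T "\<lambda>t. \<kappa> (S t)"])
      show "continuous_on {0..T} (\<lambda>t. \<kappa> (S t))"
        by (rule DERIV_continuous_on[where D = "\<lambda>t. \<kappa>' (S t)"]) (rule rate_along_loopD[OF \<kappa> S(2)])
      fix t assume "t \<in> {0..T}"
      then show "nussbaum_primitive b (\<kappa> (S t)) \<ge> - C"
        using S solution_reachable[of "{0..T}" S t] by (intro low) auto
    qed (use S in auto)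
    then show ?thesis using S by simp
  qed
  then show ?thesis by (auto simp: bounded_iff)
qed

definition estimation_error :: "'n state \<Rightarrow> real ^ 'n ^ 'n" where
  "estimation_error s = (\<chi> i. st_z s $ i - st_y s)"

text \<open>
  The Lyapunov function of the seeking dynamics.
\<close>

definition V_seek :: "'n state \<Rightarrow> real" where
  "V_seek s = (\<Sum>i\<in>UNIV. (st_y s $ i - xstar $ i)\<^sup>2) / 2 +
     (\<Sum>i\<in>UNIV. \<Sum>j\<in>UNIV. w i j * (st_z s $ i $ j - st_y s $ j)\<^sup>2) / 2"

definition V_seek_rate :: "'n state \<Rightarrow> real" where
  "V_seek_rate s = (\<Sum>i\<in>UNIV. (st_y s $ i - xstar $ i) * y_rate f i s) +
     (\<Sum>i\<in>UNIV. \<Sum>j\<in>UNIV. w i j * (st_z s $ i $ j - st_y s $ j) * (z_rate i j s - y_rate f j s))"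

lemma V_seek_rate_along_loop: "rate_along_loop V_seek V_seek_rate"
  unfolding rate_along_loop_def
proof (intro allI impI)
  fix I S t assume S: "solves_on I S" "t \<in> I"
  note D = solves_on_deriv[OF S]
  show "((\<lambda>\<tau>. V_seek (S \<tau>)) has_real_derivative V_seek_rate (S t)) (at t within I)"
    unfolding V_seek_def V_seek_rate_def
    by (rule derivative_eq_intros D refl | simp add: sum_divide_distrib mult_ac)+
qed

lemma V_seek_rate_le:
  "V_seek_rate s \<le> - c * ((norm (st_y s - xstar))\<^sup>2 + (norm (estimation_error s))\<^sup>2)"
  using dissipation unfolding seeking_dissipates_def V_seek_rate_def estimation_error_def y_rate_def z_rate_def
  by blast

lemma V_seek_rate_nonpos: "V_seek_rate s \<le> 0"
  by (rule order_trans[OF V_seek_rate_le]) (use c_pos in \<open>simp add: mult_nonneg_nonneg\<close>)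

lemma V_seek_ge:
  "(st_y s $ i - xstar $ i)\<^sup>2 \<le> 2 * V_seek s"
  "w i j * (st_z s $ i $ j - st_y s $ j)\<^sup>2 \<le> 2 * V_seek s"
  "0 \<le> V_seek s"
proof -
  let ?A = "\<Sum>i\<in>UNIV. (st_y s $ i - xstar $ i)\<^sup>2"
  let ?B = "\<Sum>i\<in>UNIV. \<Sum>j\<in>UNIV. w i j * (st_z s $ i $ j - st_y s $ j)\<^sup>2"
  have w0: "w i j \<ge> 0" for i j using w_pos less_imp_le by blast
  have A: "(st_y s $ i - xstar $ i)\<^sup>2 \<le> ?A" by (rule member_le_sum) auto
  have "w i j * (st_z s $ i $ j - st_y s $ j)\<^sup>2 \<le> (\<Sum>j\<in>UNIV. w i j * (st_z s $ i $ j - st_y s $ j)\<^sup>2)"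
    by (rule member_le_sum) (auto simp: w0)
  also have "\<dots> \<le> ?B"
    by (rule member_le_sum[where f = "\<lambda>i. \<Sum>j\<in>UNIV. w i j * (st_z s $ i $ j - st_y s $ j)\<^sup>2"]) (auto simp: w0 sum_nonneg)
  finally have B: "w i j * (st_z s $ i $ j - st_y s $ j)\<^sup>2 \<le> ?B" .
  have "?A \<ge> 0" "?B \<ge> 0" by (auto intro!: sum_nonneg mult_nonneg_nonneg w0)
  then show "(st_y s $ i - xstar $ i)\<^sup>2 \<le> 2 * V_seek s"
    "w i j * (st_z s $ i $ j - st_y s $ j)\<^sup>2 \<le> 2 * V_seek s" "0 \<le> V_seek s"
    using A B by (simp_all add: V_seek_def)
qed

text \<open>
  The partial derivative of player \<open>i\<close> vanishes at the equilibrium, so its value at the estimate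
  is controlled by the distance of the estimate from the equilibrium. Thus a multiple of the dissipation of \<open>V_seek\<close> pays
  for the square of the rate of \<open>y\<^sub>i\<close>.
\<close>

lemma y_rate_square_le:
  "(y_rate f i s)\<^sup>2 \<le> 2 * (l i)\<^sup>2 * ((norm (st_y s - xstar))\<^sup>2 + (norm (estimation_error s))\<^sup>2)"
proof -
  have l0: "l i \<ge> 0" using lipschitz lipschitz_on_nonneg by blast
  let ?p = "norm (st_y s - xstar)" and ?q = "norm (estimation_error s)"
  have "norm (st_z s $ i - st_y s) \<le> ?q"
    using Finite_Cartesian_Product.norm_nth_le[of "estimation_error s" i] by (simp add: estimation_error_def)
  then have "norm (st_z s $ i - xstar) \<le> ?p + ?q"
    using norm_triangle_ineq[of "st_z s $ i - st_y s" "st_y s - xstar"] by simp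
  then have "\<bar>y_rate f i s\<bar> \<le> l i * (?p + ?q)"
    using lipschitz_on_normD[OF lipschitz[of i], of "st_z s $ i" xstar] zero[of i] l0
      mult_left_mono[of "norm (st_z s $ i - xstar)" "?p + ?q" "l i"]
    by (simp add: y_rate_def)
  then have "(y_rate f i s)\<^sup>2 \<le> (l i * (?p + ?q))\<^sup>2"
    by (metis abs_ge_zero power2_abs power_mono)
  also have "\<dots> = (l i)\<^sup>2 * (?p + ?q)\<^sup>2" by (simp add: power_mult_distrib)
  also have "\<dots> \<le> (l i)\<^sup>2 * (2 * (?p\<^sup>2 + ?q\<^sup>2))"
    using sum_squares_bound[of ?p ?q] by (intro mult_left_mono) (auto simp: power2_sum)
  finally show ?thesis by (simp add: algebra_simps)
qed

text \<open>
  The three functions \<open>\<Psi>\<close> are made to satisfy \<open>- \<alpha>' = \<Psi>\<^sub>1 \<theta>\<^sub>1 + \<Psi>\<^sub>2 + \<Psi>\<^sub>3 b\<^sub>1\<close>: they collect the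
  parts of the derivative of \<open>\<alpha>\<close> according to the unknown constant they are multiplied with.
\<close>

lemma beta_rate_along_loop:
  "rate_along_loop (beta \<phi>1 i) (\<lambda>s. b2 i * N0 (st_k2 s $ i) * eta2 f \<phi>1 \<phi>2 i s
     + \<phi>2 i (st_x s $ i, st_v s $ i) * \<theta>2 i + Psi1 \<phi>1 i s * \<theta>1 i + Psi2 f \<phi>1 i s + Psi3 \<phi>1 i s * b1 i)"
  unfolding rate_along_loop_def
proof (intro allI impI)
  fix I S t assume S: "solves_on I S" "t \<in> I"
  note D = solves_on_deriv[OF S]
  have \<phi>: "((\<lambda>\<tau>. \<phi>1 i (st_x (S \<tau>) $ i)) has_real_derivative deriv (\<phi>1 i) (st_x (S t) $ i) * x_rate i (S t)) (at t within I)"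
    by (rule DERIV_chain2[OF smooth_real_deriv(1)[OF \<phi>1_smooth] D(1)])
  have \<eta>: "((\<lambda>\<tau>. eta1 \<phi>1 i (S \<tau>)) has_real_derivative
      x_rate i (S t) - y_rate f i (S t)
      + (deriv (\<phi>1 i) (st_x (S t) $ i) * x_rate i (S t) * st_th1hat (S t) $ i
         + (\<phi>1 i (st_x (S t) $ i))\<^sup>2 * tracking_error i (S t))) (at t within I)"
    unfolding eta1_def
    by (rule derivative_eq_intros D \<phi> refl | simp add: power2_eq_square)+
  have N: "((\<lambda>\<tau>. N0 (st_k1 (S \<tau>) $ i)) has_real_derivative
      (2 * st_k1 (S t) $ i * sin (st_k1 (S t) $ i) + (st_k1 (S t) $ i)\<^sup>2 * cos (st_k1 (S t) $ i)) * k1_rate i (S t)) (at t within I)"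
    unfolding N0_def
    by (rule derivative_eq_intros D refl | simp add: algebra_simps)+
  have "((\<lambda>\<tau>. beta \<phi>1 i (S \<tau>)) has_real_derivative
      v_rate i (S t) - ((2 * st_k1 (S t) $ i * sin (st_k1 (S t) $ i) + (st_k1 (S t) $ i)\<^sup>2 * cos (st_k1 (S t) $ i)) * k1_rate i (S t) * eta1 \<phi>1 i (S t)
       + N0 (st_k1 (S t) $ i) * (x_rate i (S t) - y_rate f i (S t)
      + (deriv (\<phi>1 i) (st_x (S t) $ i) * x_rate i (S t) * st_th1hat (S t) $ i
         + (\<phi>1 i (st_x (S t) $ i))\<^sup>2 * tracking_error i (S t))))) (at t within I)"
    unfolding beta_def alpha_def
    by (rule derivative_eq_intros D \<eta> N refl | simp)+
  then show "((\<lambda>\<tau>. beta \<phi>1 i (S \<tau>)) has_real_derivative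
     b2 i * N0 (st_k2 (S t) $ i) * eta2 f \<phi>1 \<phi>2 i (S t)
     + \<phi>2 i (st_x (S t) $ i, st_v (S t) $ i) * \<theta>2 i + Psi1 \<phi>1 i (S t) * \<theta>1 i + Psi2 f \<phi>1 i (S t) + Psi3 \<phi>1 i (S t) * b1 i) (at t within I)"
    by (rule DERIV_cong)
       (simp add: v_rate_def control_def Psi1_def Psi2_def Psi3_def k1_rate_def x_rate_def tracking_error_def
         algebra_simps power2_eq_square)
qed

text \<open>
  The second backstepping stage: the virtual control error and the errors of all parameters with a bar.
\<close>

definition V_beta :: "'n \<Rightarrow> 'n state \<Rightarrow> real" where
  "V_beta i s = ((beta \<phi>1 i s)\<^sup>2 + (\<theta>2 i - st_th2bar s $ i)\<^sup>2 + (\<theta>1 i - st_th1bar s $ i)\<^sup>2 + (b1 i - st_b1bar s $ i)\<^sup>2) / 2"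

text \<open>
  By the update laws the derivative of \<open>V_beta\<close> is \<open>- \<beta>\<^sup>2\<close> plus \<open>(b\<^sub>2 N\<^sub>0(k\<^sub>2) + 1) k\<^sub>2'\<close>, and the subtracted primitive
  removes the second term.
\<close>

definition W_beta :: "'n \<Rightarrow> 'n state \<Rightarrow> real" where
  "W_beta i s = V_beta i s - nussbaum_primitive (b2 i) (st_k2 s $ i)"

lemma nussbaum_chain:
  assumes "(g has_real_derivative g') (at t within I)"
  shows "((\<lambda>\<tau>. nussbaum_primitive b (g \<tau>)) has_real_derivative (b * N0 (g t) + 1) * g') (at t within I)"
  by (rule DERIV_chain2[OF nussbaum_primitive_deriv assms])

lemma W_beta_rate_along_loop: "rate_along_loop (W_beta i) (\<lambda>s. - (beta \<phi>1 i s)\<^sup>2)"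
  unfolding rate_along_loop_def
proof (intro allI impI)
  fix I S t assume S: "solves_on I S" "t \<in> I"
  note D = solves_on_deriv[OF S]
  note \<beta> = rate_along_loopD[OF beta_rate_along_loop[of i] S]
  let ?s = "S t"
  have V: "((\<lambda>\<tau>. V_beta i (S \<tau>)) has_real_derivative
      beta \<phi>1 i ?s * (b2 i * N0 (st_k2 ?s $ i) * eta2 f \<phi>1 \<phi>2 i ?s
        + \<phi>2 i (st_x ?s $ i, st_v ?s $ i) * \<theta>2 i + Psi1 \<phi>1 i ?s * \<theta>1 i + Psi2 f \<phi>1 i ?s + Psi3 \<phi>1 i ?s * b1 i)
      - (\<theta>2 i - st_th2bar ?s $ i) * (beta \<phi>1 i ?s * \<phi>2 i (st_x ?s $ i, st_v ?s $ i))
      - (\<theta>1 i - st_th1bar ?s $ i) * (beta \<phi>1 i ?s * Psi1 \<phi>1 i ?s)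
      - (b1 i - st_b1bar ?s $ i) * (beta \<phi>1 i ?s * Psi3 \<phi>1 i ?s)) (at t within I)"
    unfolding V_beta_def
    by (rule derivative_eq_intros D \<beta> refl | simp)+
  show "((\<lambda>\<tau>. W_beta i (S \<tau>)) has_real_derivative - (beta \<phi>1 i (S t))\<^sup>2) (at t within I)"
    unfolding W_beta_def by (rule DERIV_cong[OF DERIV_diff[OF V nussbaum_chain[OF D(7)]]])
      (simp add: k2_rate_def eta2_def algebra_simps power2_eq_square)
qed

text \<open>
  The first backstepping stage: the tracking error and the error of the parameter with a hat.
\<close>

definition V_track :: "'n \<Rightarrow> 'n state \<Rightarrow> real" where
  "V_track i s = ((tracking_error i s)\<^sup>2 + (\<theta>1 i - st_th1hat s $ i)\<^sup>2) / 2"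

definition tracking_error_rate :: "'n \<Rightarrow> 'n state \<Rightarrow> real" where
  "tracking_error_rate i s = x_rate i s - y_rate f i s"

lemma tracking_error_rate_along_loop: "rate_along_loop (tracking_error i) (tracking_error_rate i)"
  unfolding rate_along_loop_def tracking_error_def tracking_error_rate_def
  by (intro allI impI DERIV_diff solves_on_deriv)

definition W_track :: "'n \<Rightarrow> 'n state \<Rightarrow> real" where
  "W_track i s = V_track i s - nussbaum_primitive (b1 i) (st_k1 s $ i)"

text \<open>
  As for \<open>W_beta\<close>, the primitive removes the term with the unknown gain. Two couplings are left, as the
  actual \<open>v\<close> differs from the virtual control \<open>\<alpha>\<close> by \<open>\<beta>\<close>, and the reference \<open>y\<close> moves.
\<close>

lemma W_track_rate_along_loop:
  "rate_along_loop (W_track i) (\<lambda>s. - (tracking_error i s)\<^sup>2 + b1 i * tracking_error i s * beta \<phi>1 i s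
     - tracking_error i s * y_rate f i s)"
  unfolding rate_along_loop_def
proof (intro allI impI)
  fix I S t assume S: "solves_on I S" "t \<in> I"
  note D = solves_on_deriv[OF S]
  note e = rate_along_loopD[OF tracking_error_rate_along_loop[of i] S]
  let ?s = "S t"
  have V: "((\<lambda>\<tau>. V_track i (S \<tau>)) has_real_derivative
      tracking_error i ?s * tracking_error_rate i ?s
      - (\<theta>1 i - st_th1hat ?s $ i) * (\<phi>1 i (st_x ?s $ i) * tracking_error i ?s)) (at t within I)"
    unfolding V_track_def
    by (rule derivative_eq_intros D e refl | simp)+
  show "((\<lambda>\<tau>. W_track i (S \<tau>)) has_real_derivative - (tracking_error i (S t))\<^sup>2 + b1 i * tracking_error i (S t) * beta \<phi>1 i (S t)
     - tracking_error i (S t) * y_rate f i (S t)) (at t within I)"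
    unfolding W_track_def by (rule DERIV_cong[OF DERIV_diff[OF V nussbaum_chain[OF D(5)]]])
      (simp add: tracking_error_rate_def k1_rate_def x_rate_def beta_def alpha_def eta1_def
         tracking_error_def[symmetric] algebra_simps power2_eq_square)
qed

text \<open>
  The coefficients are chosen such that the dissipation of \<open>W_beta\<close> and of \<open>V_seek\<close> absorbs the couplings in the
  derivative of \<open>W_track\<close>.
\<close>

definition W_total :: "'n \<Rightarrow> 'n state \<Rightarrow> real" where
  "W_total i s = W_track i s + (b1 i)\<^sup>2 * W_beta i s + 2 * (l i)\<^sup>2 / c * V_seek s"

definition W_total_rate :: "'n \<Rightarrow> 'n state \<Rightarrow> real" where
  "W_total_rate i s = - (tracking_error i s)\<^sup>2 + b1 i * tracking_error i s * beta \<phi>1 i s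
     - tracking_error i s * y_rate f i s + (b1 i)\<^sup>2 * (- (beta \<phi>1 i s)\<^sup>2)
     + 2 * (l i)\<^sup>2 / c * V_seek_rate s"

lemma W_total_rate_along_loop: "rate_along_loop (W_total i) (W_total_rate i)"
  using W_track_rate_along_loop[of i] W_beta_rate_along_loop[of i] V_seek_rate_along_loop
  unfolding rate_along_loop_def W_total_def W_total_rate_def
  by (intro allI impI DERIV_add DERIV_cmult) blast+

text \<open>
  By Young's inequality each of the two couplings costs a quarter of the square of the tracking error,
  so half of the square is left.
\<close>

lemma W_total_rate_le: "W_total_rate i s \<le> - (1 / 2) * (tracking_error i s)\<^sup>2"
proof -
  let ?e = "tracking_error i s" and ?b = "b1 i * beta \<phi>1 i s" and ?r = "y_rate f i s"
  let ?E = "(norm (st_y s - xstar))\<^sup>2 + (norm (estimation_error s))\<^sup>2"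
  have "2 * (l i)\<^sup>2 / c * V_seek_rate s \<le> 2 * (l i)\<^sup>2 / c * (- c * ?E)"
    using c_pos by (intro mult_left_mono V_seek_rate_le) auto
  also have "\<dots> = - (2 * (l i)\<^sup>2 * ?E)" using c_pos by simp
  also have "\<dots> \<le> - ?r\<^sup>2" using y_rate_square_le[of i s] by simp
  finally have 1: "2 * (l i)\<^sup>2 / c * V_seek_rate s \<le> - ?r\<^sup>2" .
  have "0 \<le> (?e / 2 - ?b)\<^sup>2" "0 \<le> (?e / 2 + ?r)\<^sup>2" by simp_all
  then have 2: "?e * ?b \<le> ?e\<^sup>2 / 4 + ?b\<^sup>2" "- (?e * ?r) \<le> ?e\<^sup>2 / 4 + ?r\<^sup>2"
    by (simp_all add: power2_eq_square field_simps)
  have "W_total_rate i s = - ?e\<^sup>2 + ?e * ?b - ?e * ?r - ?b\<^sup>2 + 2 * (l i)\<^sup>2 / c * V_seek_rate s"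
    by (simp add: W_total_rate_def power_mult_distrib mult_ac)
  then show ?thesis using 1 2 by simp
qed

lemma W_total_rate_nonpos: "W_total_rate i s \<le> 0"
  by (rule order_trans[OF W_total_rate_le]) simp

lemma continuous_N0: "continuous_on UNIV N0"
  unfolding N0_def[abs_def] by (intro continuous_intros)

lemma continuous_nussbaum_primitive: "continuous_on UNIV (nussbaum_primitive b)"
  unfolding nussbaum_primitive_def[abs_def] by (intro continuous_intros)

context
  fixes s0 :: "'n state"
begin

abbreviation "bounded_on_reachable q \<equiv> bounded (q ` reachable s0)"

lemma y_bounded: "bounded_on_reachable (\<lambda>s. st_y s $ i)"
proof -
  have "bounded_on_reachable (\<lambda>s. st_y s $ i - xstar $ i)"
  proof (rule bounded_of_square_le)
    fix s assume s: "s \<in> reachable s0"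
    show "(st_y s $ i - xstar $ i)\<^sup>2 \<le> 2 * V_seek s0"
      using V_seek_ge(1)[of s i] nonincreasing_on_reachable[OF V_seek_rate_along_loop V_seek_rate_nonpos s] by linarith
  qed
  from bounded_real_comp_arith(1)[OF this bounded_const_image[of "xstar $ i"]] show ?thesis by simp
qed

lemma z_bounded: "bounded_on_reachable (\<lambda>s. st_z s $ i $ j)"
proof -
  have "bounded_on_reachable (\<lambda>s. st_z s $ i $ j - st_y s $ j)"
  proof (rule bounded_of_square_le)
    fix s assume s: "s \<in> reachable s0"
    have "w i j * (st_z s $ i $ j - st_y s $ j)\<^sup>2 \<le> 2 * V_seek s0"
      using V_seek_ge(2)[of i j s] nonincreasing_on_reachable[OF V_seek_rate_along_loop V_seek_rate_nonpos s] by linarith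
    then show "(st_z s $ i $ j - st_y s $ j)\<^sup>2 \<le> 2 * V_seek s0 / w i j"
      using w_pos[of i j] by (simp add: field_simps)
  qed
  from bounded_real_comp_arith(1)[OF this y_bounded[of j]] show ?thesis by simp
qed

lemma y_rate_bounded: "bounded_on_reachable (y_rate f i)"
proof -
  have "bounded_on_reachable (\<lambda>s. st_z s $ i)" by (rule bounded_vec_image) (rule z_bounded)
  then have "bounded_on_reachable (\<lambda>s. - partial i (f i) (st_z s $ i))"
    by (rule bounded_continuous_comp[rotated])
       (intro continuous_on_minus lipschitz_on_continuous_on[OF lipschitz])
  then show ?thesis by (simp add: y_rate_def[abs_def])
qed

lemma k2_rate_along_loop: "rate_along_loop (\<lambda>s. st_k2 s $ i) (k2_rate i)"
  unfolding rate_along_loop_def by (blast intro: solves_on_deriv)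

lemma k1_rate_along_loop: "rate_along_loop (\<lambda>s. st_k1 s $ i) (k1_rate i)"
  unfolding rate_along_loop_def by (blast intro: solves_on_deriv)

lemma V_beta_nonneg: "0 \<le> V_beta i s" by (simp add: V_beta_def)
lemma V_track_nonneg: "0 \<le> V_track i s" by (simp add: V_track_def)

text \<open>
  A bounded gain makes its primitive bounded, which turns the nonincreasing functions into bounds on their quadratic
  parts.
\<close>

lemma nussbaum_primitive_bounded:
  assumes "bounded_on_reachable q"
  shows "\<exists>B. \<forall>s\<in>reachable s0. nussbaum_primitive b (q s) \<le> B \<and> - B \<le> nussbaum_primitive b (q s)"
proof -
  obtain B where B: "\<And>s. s \<in> reachable s0 \<Longrightarrow> \<bar>nussbaum_primitive b (q s)\<bar> \<le> B"
    using bounded_imp_upper[OF bounded_continuous_comp[OF continuous_nussbaum_primitive assms]] by blast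
  have "nussbaum_primitive b (q s) \<le> B \<and> - B \<le> nussbaum_primitive b (q s)" if "s \<in> reachable s0" for s
    using B[OF that] by linarith
  then show ?thesis by blast
qed

lemma W_beta_le:
  assumes "s \<in> reachable s0"
  shows "V_beta i s \<le> W_beta i s0 + nussbaum_primitive (b2 i) (st_k2 s $ i)"
proof -
  have "W_beta i s \<le> W_beta i s0"
    by (rule nonincreasing_on_reachable[OF W_beta_rate_along_loop _ assms]) simp
  then show ?thesis by (simp add: W_beta_def[of i s])
qed

text \<open>
  Since \<open>V_beta\<close> is nonnegative, the inequality \<open>W_beta_le\<close> bounds the primitive from below.
\<close>

lemma k2_bounded: "bounded_on_reachable (\<lambda>s. st_k2 s $ i)"
proof (rule gain_bounded_on_reachable[OF k2_rate_along_loop b2_nonzero[of i], where C = "W_beta i s0"])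
  fix s assume s: "s \<in> reachable s0"
  show "nussbaum_primitive (b2 i) (st_k2 s $ i) \<ge> - (W_beta i s0)"
    using W_beta_le[OF s, of i] V_beta_nonneg[of i s] by linarith
qed

lemma beta_and_bar_estimates_bounded:
  "bounded_on_reachable (beta \<phi>1 i)"
  "bounded_on_reachable (\<lambda>s. st_th2bar s $ i)"
  "bounded_on_reachable (\<lambda>s. st_th1bar s $ i)"
  "bounded_on_reachable (\<lambda>s. st_b1bar s $ i)"
proof -
  obtain B where "\<forall>s\<in>reachable s0. nussbaum_primitive (b2 i) (st_k2 s $ i) \<le> B \<and> - B \<le> nussbaum_primitive (b2 i) (st_k2 s $ i)"
    using nussbaum_primitive_bounded[OF k2_bounded] by (rule exE)
  then have B: "nussbaum_primitive (b2 i) (st_k2 s $ i) \<le> B" and B': "- B \<le> nussbaum_primitive (b2 i) (st_k2 s $ i)"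
    if "s \<in> reachable s0" for s
    using that by simp_all
  have le: "2 * V_beta i s \<le> 2 * (W_beta i s0 + B)" if "s \<in> reachable s0" for s
  proof -
    have "V_beta i s \<le> W_beta i s0 + B" using W_beta_le[OF that, of i] B[OF that] by linarith
    then show ?thesis by simp
  qed
  have sq: "(beta \<phi>1 i s)\<^sup>2 \<le> 2 * V_beta i s" "(\<theta>2 i - st_th2bar s $ i)\<^sup>2 \<le> 2 * V_beta i s"
    "(\<theta>1 i - st_th1bar s $ i)\<^sup>2 \<le> 2 * V_beta i s" "(b1 i - st_b1bar s $ i)\<^sup>2 \<le> 2 * V_beta i s" for s
    by (simp_all add: V_beta_def)
  show "bounded_on_reachable (beta \<phi>1 i)"
    by (rule bounded_of_square_le) (rule order_trans[OF sq(1) le])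
  show "bounded_on_reachable (\<lambda>s. st_th2bar s $ i)"
    by (rule bounded_of_offset_square_le) (rule order_trans[OF sq(2) le])
  show "bounded_on_reachable (\<lambda>s. st_th1bar s $ i)"
    by (rule bounded_of_offset_square_le) (rule order_trans[OF sq(3) le])
  show "bounded_on_reachable (\<lambda>s. st_b1bar s $ i)"
    by (rule bounded_of_offset_square_le) (rule order_trans[OF sq(4) le])
qed

text \<open>
  Because \<open>k\<^sub>2\<close> is bounded, \<open>W_beta\<close> is bounded below; as \<open>V_seek\<close> is nonnegative, \<open>W_total\<close> is, up to a constant, at least
  \<open>V_track\<close> minus the primitive. Since \<open>W_total\<close> never exceeds its initial value, this gives the first inequality, which will
  trap \<open>k\<^sub>1\<close>. As \<open>V_track\<close> is nonnegative, it also gives the second one, which becomes the lower bound that Barbalat's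
  argument needs once \<open>k\<^sub>1\<close> is known to be bounded.
\<close>

lemma V_track_and_W_total_bound:
  "\<exists>C. \<forall>s\<in>reachable s0. V_track i s \<le> C + nussbaum_primitive (b1 i) (st_k1 s $ i) \<and> W_total i s \<ge> - C - nussbaum_primitive (b1 i) (st_k1 s $ i)"
proof -
  obtain B where "\<forall>s\<in>reachable s0. nussbaum_primitive (b2 i) (st_k2 s $ i) \<le> B \<and> - B \<le> nussbaum_primitive (b2 i) (st_k2 s $ i)"
    using nussbaum_primitive_bounded[OF k2_bounded] by (rule exE)
  then have B: "nussbaum_primitive (b2 i) (st_k2 s $ i) \<le> B" and B': "- B \<le> nussbaum_primitive (b2 i) (st_k2 s $ i)"
    if "s \<in> reachable s0" for s
    using that by simp_all
  define C where "C = \<bar>W_total i s0\<bar> + (b1 i)\<^sup>2 * B"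
  have "V_track i s \<le> C + nussbaum_primitive (b1 i) (st_k1 s $ i) \<and> W_total i s \<ge> - C - nussbaum_primitive (b1 i) (st_k1 s $ i)"
    if s: "s \<in> reachable s0" for s
  proof -
    have "W_beta i s \<ge> - B" using B[OF s] V_beta_nonneg[of i s] by (simp add: W_beta_def)
    then have "(b1 i)\<^sup>2 * W_beta i s \<ge> (b1 i)\<^sup>2 * (- B)" by (intro mult_left_mono) auto
    moreover have "2 * (l i)\<^sup>2 / c * V_seek s \<ge> 0" using c_pos V_seek_ge(3)[of s] by simp
    ultimately have "W_total i s \<ge> V_track i s - nussbaum_primitive (b1 i) (st_k1 s $ i) - (b1 i)\<^sup>2 * B"
      by (simp add: W_total_def W_track_def)
    then show ?thesis
      using nonincreasing_on_reachable[OF W_total_rate_along_loop W_total_rate_nonpos s, of i] V_track_nonneg[of i s]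
        abs_ge_self[of "W_total i s0"]
      unfolding C_def by (intro conjI) linarith+
  qed
  then show ?thesis by blast
qed

lemma k1_bounded: "bounded_on_reachable (\<lambda>s. st_k1 s $ i)"
proof -
  obtain C where C: "\<And>s. s \<in> reachable s0 \<Longrightarrow> V_track i s \<le> C + nussbaum_primitive (b1 i) (st_k1 s $ i)"
    using V_track_and_W_total_bound by blast
  show ?thesis
  proof (rule gain_bounded_on_reachable[OF k1_rate_along_loop b1_nonzero[of i], where C = C])
    fix s assume s: "s \<in> reachable s0"
    show "nussbaum_primitive (b1 i) (st_k1 s $ i) \<ge> - C"
      using C[OF s] V_track_nonneg[of i s] by linarith
  qed
qed

lemma W_total_bounded_below: "\<exists>B. \<forall>s\<in>reachable s0. W_total i s \<ge> B"
proof -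
  obtain B where "\<forall>s\<in>reachable s0. nussbaum_primitive (b1 i) (st_k1 s $ i) \<le> B \<and> - B \<le> nussbaum_primitive (b1 i) (st_k1 s $ i)"
    using nussbaum_primitive_bounded[OF k1_bounded] by (rule exE)
  then have B: "nussbaum_primitive (b1 i) (st_k1 s $ i) \<le> B" and B': "- B \<le> nussbaum_primitive (b1 i) (st_k1 s $ i)"
    if "s \<in> reachable s0" for s
    using that by simp_all
  obtain C where C: "\<And>s. s \<in> reachable s0 \<Longrightarrow> W_total i s \<ge> - C - nussbaum_primitive (b1 i) (st_k1 s $ i)"
    using V_track_and_W_total_bound by blast
  have "W_total i s \<ge> - C - B" if "s \<in> reachable s0" for s using B[OF that] C[OF that] by linarith
  then show ?thesis by blast
qed

lemma tracking_error_and_hat_estimate_bounded: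
  "bounded_on_reachable (tracking_error i)"
  "bounded_on_reachable (\<lambda>s. st_th1hat s $ i)"
proof -
  obtain B where "\<forall>s\<in>reachable s0. nussbaum_primitive (b1 i) (st_k1 s $ i) \<le> B \<and> - B \<le> nussbaum_primitive (b1 i) (st_k1 s $ i)"
    using nussbaum_primitive_bounded[OF k1_bounded] by (rule exE)
  then have B: "nussbaum_primitive (b1 i) (st_k1 s $ i) \<le> B" and B': "- B \<le> nussbaum_primitive (b1 i) (st_k1 s $ i)"
    if "s \<in> reachable s0" for s
    using that by simp_all
  obtain C where C: "\<And>s. s \<in> reachable s0 \<Longrightarrow> V_track i s \<le> C + nussbaum_primitive (b1 i) (st_k1 s $ i)"
    using V_track_and_W_total_bound by blast
  have le: "2 * V_track i s \<le> 2 * (C + B)" if "s \<in> reachable s0" for s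
  proof -
    have "V_track i s \<le> C + B" using C[OF that] B[OF that] by linarith
    then show ?thesis by simp
  qed
  have sq: "(tracking_error i s)\<^sup>2 \<le> 2 * V_track i s" "(\<theta>1 i - st_th1hat s $ i)\<^sup>2 \<le> 2 * V_track i s" for s
    by (simp_all add: V_track_def)
  show "bounded_on_reachable (tracking_error i)"
    by (rule bounded_of_square_le) (rule order_trans[OF sq(1) le])
  show "bounded_on_reachable (\<lambda>s. st_th1hat s $ i)"
    by (rule bounded_of_offset_square_le) (rule order_trans[OF sq(2) le])
qed

lemma x_bounded: "bounded_on_reachable (\<lambda>s. st_x s $ i)"
  using bounded_real_comp_arith(1)[OF tracking_error_and_hat_estimate_bounded(1)[of i] y_bounded[of i]]
  by (simp add: tracking_error_def)

lemma \<phi>1_bounded: "bounded_on_reachable (\<lambda>s. \<phi>1 i (st_x s $ i))"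
  by (rule bounded_continuous_comp[OF smooth_imp_continuous[OF \<phi>1_smooth] x_bounded])

lemma v_bounded: "bounded_on_reachable (\<lambda>s. st_v s $ i)"
proof -
  have "bounded_on_reachable (\<lambda>s. beta \<phi>1 i s + N0 (st_k1 s $ i) *
      (tracking_error i s + \<phi>1 i (st_x s $ i) * st_th1hat s $ i))"
    by (intro bounded_real_comp_arith beta_and_bar_estimates_bounded tracking_error_and_hat_estimate_bounded \<phi>1_bounded
        bounded_continuous_comp[OF continuous_N0] k1_bounded)
  then show ?thesis by (simp add: beta_def alpha_def eta1_def tracking_error_def)
qed

lemma tracking_error_rate_bounded: "bounded_on_reachable (tracking_error_rate i)"
  unfolding tracking_error_rate_def[abs_def] x_rate_def
  by (intro bounded_real_comp_arith bounded_const_image v_bounded \<phi>1_bounded y_rate_bounded)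

end

lemma dissipated_signal_tendsto:
  assumes S: "solves_on {0..} S"
    and Q: "rate_along_loop Q Q'" and diss: "\<And>s. Q' s \<le> - d * (g s)\<^sup>2" and d: "d > 0"
    and below: "\<And>s. s \<in> reachable (S 0) \<Longrightarrow> Q s \<ge> q"
    and g: "rate_along_loop g g'" and g': "bounded (g' ` reachable (S 0))"
  shows "((\<lambda>t. g (S t)) \<longlongrightarrow> 0) at_top"
proof -
  have R: "S t \<in> reachable (S 0)" if "t \<ge> 0" for t
    by (rule solution_reachable[OF S]) (use that in auto)
  obtain K where K: "\<And>s. s \<in> reachable (S 0) \<Longrightarrow> \<bar>g' s\<bar> \<le> K"
    using bounded_imp_upper[OF g'] by blast
  show ?thesis
  proof (rule barbalat_dissipation[where Q = "\<lambda>t. Q (S t)" and Q' = "\<lambda>t. Q' (S t)" and c = d and q = q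
        and g' = "\<lambda>t. g' (S t)" and K = K])
    fix t :: real assume t: "t \<ge> 0"
    then have t': "t \<in> {0..}" by simp
    show "((\<lambda>t. Q (S t)) has_real_derivative Q' (S t)) (at t within {0..})"
      by (rule rate_along_loopD[OF Q S t'])
    show "((\<lambda>t. g (S t)) has_real_derivative g' (S t)) (at t within {0..})"
      by (rule rate_along_loopD[OF g S t'])
    show "Q' (S t) \<le> - d * (g (S t))\<^sup>2" by (rule diss)
    show "q \<le> Q (S t)" by (rule below[OF R[OF t]])
    show "\<bar>g' (S t)\<bar> \<le> K" by (rule K[OF R[OF t]])
  qed (rule d)
qed

text \<open>
  The position is the sum of \<open>y\<close>, which converges by the dissipation of \<open>V_seek\<close>, and of the tracking error, which
  vanishes by the dissipation of \<open>W_total\<close>.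
\<close>

lemma x_tendsto:
  assumes S: "solves_on {0..} S"
  shows "((\<lambda>t. norm (st_x (S t) - xstar)) \<longlongrightarrow> 0) at_top"
proof -
  have y: "((\<lambda>t. st_y (S t) $ i - xstar $ i) \<longlongrightarrow> 0) at_top" for i
  proof (rule dissipated_signal_tendsto[OF S V_seek_rate_along_loop _ c_pos, where q = 0])
    fix s :: "'n state"
    have "(st_y s $ i - xstar $ i)\<^sup>2 \<le> (norm (st_y s - xstar))\<^sup>2"
      using power_mono[OF Finite_Cartesian_Product.norm_nth_le[of "st_y s - xstar" i], of 2] by simp
    then have "c * (st_y s $ i - xstar $ i)\<^sup>2 \<le> c * ((norm (st_y s - xstar))\<^sup>2 + (norm (estimation_error s))\<^sup>2)"
      using c_pos by (intro mult_left_mono) (auto intro: order_trans)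
    then show "V_seek_rate s \<le> - c * (st_y s $ i - xstar $ i)\<^sup>2"
      using V_seek_rate_le[of s] by linarith
  next
    show "rate_along_loop (\<lambda>s. st_y s $ i - xstar $ i) (y_rate f i)"
      unfolding rate_along_loop_def
    proof (intro allI impI)
      fix I S t assume "solves_on I S" "t \<in> I"
      from DERIV_diff[OF solves_on_deriv(3)[OF this, of i] DERIV_const[of "xstar $ i"]]
      show "((\<lambda>\<tau>. st_y (S \<tau>) $ i - xstar $ i) has_real_derivative y_rate f i (S t)) (at t within I)"
        by simp
    qed
  qed (auto intro: V_seek_ge(3) y_rate_bounded)
  have e: "((\<lambda>t. tracking_error i (S t)) \<longlongrightarrow> 0) at_top" for i
  proof -
    obtain B where B: "\<And>s. s \<in> reachable (S 0) \<Longrightarrow> W_total i s \<ge> B" using W_total_bounded_below by blast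
    show ?thesis
      by (rule dissipated_signal_tendsto[OF S W_total_rate_along_loop W_total_rate_le _ B
            tracking_error_rate_along_loop tracking_error_rate_bounded]) simp_all
  qed
  have "((\<lambda>t. st_x (S t) - xstar) \<longlongrightarrow> 0) at_top"
  proof (rule vec_tendstoI)
    fix i
    have "((\<lambda>t. tracking_error i (S t) + (st_y (S t) $ i - xstar $ i)) \<longlongrightarrow> 0 + 0) at_top"
      by (intro tendsto_add e y)
    then show "((\<lambda>t. (st_x (S t) - xstar) $ i) \<longlongrightarrow> 0 $ i) at_top" by (simp add: tracking_error_def)
  qed
  then show ?thesis by (rule tendsto_norm_zero)
qed

end

section \<open>Existence of global closed-loop solutions\<close>

text \<open>
  The existence theorem is about Euclidean spaces, so the state record is identified with a tuple of vectors.
\<close>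

type_synonym 'n flat_state = "(real ^ 'n) \<times> (real ^ 'n) \<times> (real ^ 'n) \<times> (real ^ 'n ^ 'n) \<times> (real ^ 'n) \<times>
  (real ^ 'n) \<times> (real ^ 'n) \<times> (real ^ 'n) \<times> (real ^ 'n) \<times> (real ^ 'n)"

definition flatten :: "'n::finite state \<Rightarrow> 'n flat_state" where
  "flatten s = (st_x s, st_v s, st_y s, st_z s, st_k1 s, st_th1hat s, st_k2 s, st_th2bar s, st_th1bar s, st_b1bar s)"

definition unflatten :: "'n::finite flat_state \<Rightarrow> 'n state" where
  "unflatten p = (case p of (x, v, y, z, k1, h, k2, q2, q1, b) \<Rightarrow>
     \<lparr>st_x = x, st_v = v, st_y = y, st_z = z, st_k1 = k1, st_th1hat = h, st_k2 = k2, st_th2bar = q2, st_th1bar = q1, st_b1bar = b\<rparr>)"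

lemma unflatten_flatten [simp]: "unflatten (flatten s) = s"
  by (cases s) (simp add: unflatten_def flatten_def)

lemma flatten_unflatten [simp]: "flatten (unflatten p) = p"
  by (simp add: unflatten_def flatten_def split: prod.split)

lemma unflatten_components:
  "st_x (unflatten p) = fst p"
  "st_v (unflatten p) = fst (snd p)"
  "st_y (unflatten p) = fst (snd (snd p))"
  "st_z (unflatten p) = fst (snd (snd (snd p)))"
  "st_k1 (unflatten p) = fst (snd (snd (snd (snd p))))"
  "st_th1hat (unflatten p) = fst (snd (snd (snd (snd (snd p)))))"
  "st_k2 (unflatten p) = fst (snd (snd (snd (snd (snd (snd p))))))"
  "st_th2bar (unflatten p) = fst (snd (snd (snd (snd (snd (snd (snd p)))))))"
  "st_th1bar (unflatten p) = fst (snd (snd (snd (snd (snd (snd (snd (snd p))))))))"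
  "st_b1bar (unflatten p) = snd (snd (snd (snd (snd (snd (snd (snd (snd p))))))))"
  by (simp_all add: unflatten_def split: prod.split)

lemma bounded_linear_nth_comp: "bounded_linear g \<Longrightarrow> bounded_linear (\<lambda>x. g x $ i)"
  by (rule bounded_linear_compose[OF bounded_linear_vec_nth])

lemma bounded_linear_unflatten:
  "bounded_linear (\<lambda>p. st_x (unflatten p))"
  "bounded_linear (\<lambda>p. st_v (unflatten p))"
  "bounded_linear (\<lambda>p. st_y (unflatten p))"
  "bounded_linear (\<lambda>p. st_z (unflatten p))"
  "bounded_linear (\<lambda>p. st_k1 (unflatten p))"
  "bounded_linear (\<lambda>p. st_th1hat (unflatten p))"
  "bounded_linear (\<lambda>p. st_k2 (unflatten p))"
  "bounded_linear (\<lambda>p. st_th2bar (unflatten p))"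
  "bounded_linear (\<lambda>p. st_th1bar (unflatten p))"
  "bounded_linear (\<lambda>p. st_b1bar (unflatten p))"
  unfolding unflatten_components
  by (intro bounded_linear_fst_comp bounded_linear_snd_comp bounded_linear_ident)+

lemmas boundedly_lipschitz_unflatten =
  bounded_linear_unflatten[THEN bounded_linear_nth_comp, THEN bounded_linear_imp_boundedly_lipschitz]

context closed_loop
begin

definition loop_field :: "'n flat_state \<Rightarrow> 'n flat_state" where
  "loop_field p = (let s = unflatten p in
     (\<chi> i. x_rate i s, \<chi> i. v_rate i s, \<chi> i. y_rate f i s, \<chi> i. \<chi> j. z_rate i j s,
      \<chi> i. k1_rate i s, \<chi> i. \<phi>1 i (st_x s $ i) * tracking_error i s,
      \<chi> i. k2_rate i s, \<chi> i. beta \<phi>1 i s * \<phi>2 i (st_x s $ i, st_v s $ i),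
      \<chi> i. beta \<phi>1 i s * Psi1 \<phi>1 i s, \<chi> i. beta \<phi>1 i s * Psi3 \<phi>1 i s))"

lemma unflatten_solves_on:
  assumes "\<And>t. t \<in> I \<Longrightarrow> (X has_vector_derivative loop_field (X t)) (at t within I)"
  shows "solves_on I (\<lambda>t. unflatten (X t))"
proof -
  have comp: "((\<lambda>\<tau>. h (X \<tau>)) has_real_derivative h (loop_field (X t))) (at t within I)"
    if "t \<in> I" "bounded_linear h" for h :: "'n flat_state \<Rightarrow> real" and t
    using bounded_linear.has_vector_derivative[OF that(2) assms[OF that(1)]]
    by (simp add: has_real_derivative_iff_has_vector_derivative)
  note C = comp[OF _ bounded_linear_unflatten(1)[THEN bounded_linear_nth_comp]]
    comp[OF _ bounded_linear_unflatten(2)[THEN bounded_linear_nth_comp]]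
    comp[OF _ bounded_linear_unflatten(3)[THEN bounded_linear_nth_comp]]
    comp[OF _ bounded_linear_unflatten(4)[THEN bounded_linear_nth_comp, THEN bounded_linear_nth_comp]]
    comp[OF _ bounded_linear_unflatten(5)[THEN bounded_linear_nth_comp]]
    comp[OF _ bounded_linear_unflatten(6)[THEN bounded_linear_nth_comp]]
    comp[OF _ bounded_linear_unflatten(7)[THEN bounded_linear_nth_comp]]
    comp[OF _ bounded_linear_unflatten(8)[THEN bounded_linear_nth_comp]]
    comp[OF _ bounded_linear_unflatten(9)[THEN bounded_linear_nth_comp]]
    comp[OF _ bounded_linear_unflatten(10)[THEN bounded_linear_nth_comp]]
  show ?thesis
    unfolding solves_on_def
    by (intro ballI allI conjI; rule DERIV_cong, rule C, assumption)
       (simp_all add: unflatten_components(1-10)[of "loop_field _"], simp_all add: loop_field_def Let_def)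
qed

text \<open>
  All ingredients are polynomials, sines, cosines, the Lipschitz partial derivatives of the costs, and smooth functions
  of one or two components. The derivative of \<open>\<phi>\<^sub>1\<close> is itself continuously differentiable by smoothness.
\<close>

lemma loop_field_boundedly_lipschitz: "boundedly_lipschitz loop_field"
proof -
  have \<phi>1: "boundedly_lipschitz (\<lambda>p. \<phi>1 i (F p))" if "boundedly_lipschitz F" for i and F :: "'n flat_state \<Rightarrow> real"
    using \<phi>1_smooth[of i] unfolding smooth_def
    by (intro boundedly_lipschitz_compose[OF C1_imp_boundedly_lipschitz that]) blast
  have d\<phi>1: "boundedly_lipschitz (\<lambda>p. deriv (\<phi>1 i) (F p))" if "boundedly_lipschitz F" for i and F :: "'n flat_state \<Rightarrow> real"
    by (rule boundedly_lipschitz_compose[OF C1_imp_boundedly_lipschitz[OF smooth_real_deriv(2)[OF \<phi>1_smooth]] that])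
  have \<phi>2: "boundedly_lipschitz (\<lambda>p. \<phi>2 i (F p))" if "boundedly_lipschitz F" for i and F :: "'n flat_state \<Rightarrow> real \<times> real"
    using \<phi>2_smooth[of i] unfolding smooth_def
    by (intro boundedly_lipschitz_compose[OF C1_imp_boundedly_lipschitz that]) blast
  have y: "boundedly_lipschitz (\<lambda>p. y_rate f i (unflatten p))" for i
    unfolding y_rate_def
    by (intro boundedly_lipschitz_minus boundedly_lipschitz_compose[OF lipschitz_imp_boundedly_lipschitz[OF lipschitz]]
       bounded_linear_imp_boundedly_lipschitz bounded_linear_nth_comp bounded_linear_unflatten)
  have z: "boundedly_lipschitz (\<lambda>p. st_z (unflatten p) $ i $ j)" for i j
    by (intro bounded_linear_imp_boundedly_lipschitz bounded_linear_nth_comp bounded_linear_unflatten)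
  show ?thesis
    unfolding loop_field_def[abs_def] Let_def x_rate_def v_rate_def z_rate_def k1_rate_def k2_rate_def
      tracking_error_def control_def eta1_def eta2_def beta_def alpha_def Psi1_def Psi2_def Psi3_def N0_def
    by (intro boundedly_lipschitz_intros boundedly_lipschitz_unflatten y z \<phi>1 d\<phi>1 \<phi>2)
qed

lemma flatten_bounded: "bounded (flatten ` reachable s0)"
proof -
  have "flatten ` reachable s0 \<subseteq> st_x ` reachable s0 \<times> st_v ` reachable s0 \<times> st_y ` reachable s0 \<times> st_z ` reachable s0 \<times>
     st_k1 ` reachable s0 \<times> st_th1hat ` reachable s0 \<times> st_k2 ` reachable s0 \<times> st_th2bar ` reachable s0 \<times>
     st_th1bar ` reachable s0 \<times> st_b1bar ` reachable s0"
    by (auto simp: flatten_def)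
  moreover have "bounded \<dots>"
    by (intro bounded_Times bounded_vec_image x_bounded v_bounded y_bounded z_bounded k1_bounded k2_bounded
        tracking_error_and_hat_estimate_bounded beta_and_bar_estimates_bounded)
  ultimately show ?thesis using bounded_subset by blast
qed

lemma global_solution_exists: "\<exists>S. solves_on {0..} S \<and> S 0 = s0"
proof -
  obtain R where R: "\<And>s. s \<in> reachable s0 \<Longrightarrow> norm (flatten s) \<le> R"
    using flatten_bounded[of s0] by (auto simp: bounded_iff)
  have "\<exists>X. X 0 = flatten s0 \<and> (\<forall>t\<ge>0. (X has_vector_derivative loop_field (X t)) (at t within {0..}))"
  proof (rule global_solution_of_a_priori_bound[where R = R])
    show "\<exists>L. L-lipschitz_on (cball 0 r) loop_field" for r
      using loop_field_boundedly_lipschitz by (simp add: boundedly_lipschitz_def)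
    fix T :: real and X
    assume T: "T \<ge> 0" and X0: "X 0 = flatten s0"
      and "\<And>t. t \<in> {0..T} \<Longrightarrow> (X has_vector_derivative loop_field (X t)) (at t within {0..T})"
    then have "solves_on {0..T} (\<lambda>t. unflatten (X t))" by (intro unflatten_solves_on)
    then have "unflatten (X T) \<in> reachable s0"
      using solution_reachable[of "{0..T}" "\<lambda>t. unflatten (X t)" T] T X0 by simp
    from R[OF this] show "norm (X T) \<le> R" by simp
  qed
  then obtain X where X0: "X 0 = flatten s0"
    and X: "\<And>t. t \<ge> 0 \<Longrightarrow> (X has_vector_derivative loop_field (X t)) (at t within {0..})" by blast
  have "solves_on {0..} (\<lambda>t. unflatten (X t))" by (rule unflatten_solves_on) (use X in simp)
  then show ?thesis using X0 by (intro exI[of _ "\<lambda>t. unflatten (X t)"]) simp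
qed

lemma bounded_signal_of_reachable:
  assumes "solves_on {0..} S" and "bounded (q ` reachable (S 0))"
  shows "bounded_signal (\<lambda>t. q (S t))"
  unfolding bounded_signal_def
  by (rule bounded_subset[OF assms(2)]) (use solution_reachable[OF assms(1)] in auto)

end

section \<open>Convergence to the Nash equilibrium\<close>

theorem theorem3:
  fixes f :: "'n::finite \<Rightarrow> real ^ 'n \<Rightarrow> real"
    and \<phi>1 :: "'n \<Rightarrow> real \<Rightarrow> real"
    and \<phi>2 :: "'n \<Rightarrow> real \<times> real \<Rightarrow> real"
    and b1 b2 \<theta>1 \<theta>2 l :: "'n \<Rightarrow> real"
    and m :: real
    and E :: "('n \<times> 'n) set"
    and a \<delta>bar :: "'n \<Rightarrow> 'n \<Rightarrow> real"
  assumes players: "CARD('n) \<ge> 2"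
    and b1_nonzero: "\<And>i. b1 i \<noteq> 0"
    and b2_nonzero: "\<And>i. b2 i \<noteq> 0"
    and \<phi>1_smooth: "\<And>i. smooth (\<phi>1 i)"
    and \<phi>2_smooth: "\<And>i. smooth (\<phi>2 i)"
    and A1_smooth: "\<And>i. C_k 1 (f i)"
    and A1_lipschitz: "\<And>i. (l i)-lipschitz_on UNIV (partial i (f i))"
    and A2_pos: "m > 0"
    and A2: "\<And>x z. (x - z) \<bullet> (pseudo_gradient f x - pseudo_gradient f z) \<ge> m * (norm (x - z))\<^sup>2"
    and A3_adjacency: "adjacency_matrix E a"
    and A3_undirected: "undirected_graph E a"
    and A3_connected: "connected_graph E"
    and A5_\<phi>1: "\<And>i X. bounded X \<Longrightarrow> bounded (\<phi>1 i ` X)"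
    and A5_deriv_\<phi>1: "\<And>i X. bounded X \<Longrightarrow> bounded (deriv (\<phi>1 i) ` X)"
    and A5_\<phi>2: "\<And>i X V. bounded X \<Longrightarrow> bounded V \<Longrightarrow> bounded (\<phi>2 i ` (X \<times> V))"
    and \<delta>bar_pos: "\<And>i j. \<delta>bar i j > 0"
  shows "\<exists>xstar. nash_equilibrium f xstar \<and> (\<forall>x. nash_equilibrium f x \<longrightarrow> x = xstar) \<and>
    (\<exists>\<delta>star>0. \<forall>\<delta>>\<delta>star. \<forall>S0.
      (\<exists>S. closed_loop_solution f a \<phi>1 \<phi>2 b1 b2 \<theta>1 \<theta>2 (\<lambda>i j. \<delta> * \<delta>bar i j) S \<and> S 0 = S0) \<and>
      (\<forall>S. closed_loop_solution f a \<phi>1 \<phi>2 b1 b2 \<theta>1 \<theta>2 (\<lambda>i j. \<delta> * \<delta>bar i j) S \<and> S 0 = S0 \<longrightarrow>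
        ((\<lambda>t. norm (st_x (S t) - xstar)) \<longlongrightarrow> 0) at_top \<and>
        (\<forall>i. bounded_signal (\<lambda>t. st_v (S t) $ i) \<and>
             bounded_signal (\<lambda>t. st_y (S t) $ i) \<and>
             (\<forall>j. bounded_signal (\<lambda>t. st_z (S t) $ i $ j)) \<and>
             bounded_signal (\<lambda>t. st_k1 (S t) $ i) \<and>
             bounded_signal (\<lambda>t. st_th1hat (S t) $ i) \<and>
             bounded_signal (\<lambda>t. st_k2 (S t) $ i) \<and>
             bounded_signal (\<lambda>t. st_th1bar (S t) $ i) \<and>
             bounded_signal (\<lambda>t. st_th2bar (S t) $ i) \<and>
             bounded_signal (\<lambda>t. st_b1bar (S t) $ i))))"
proof -
  obtain xstar where zero: "pseudo_gradient f xstar = 0" and nash: "nash_equilibrium f xstar"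
    and unique: "\<forall>x. nash_equilibrium f x \<longrightarrow> x = xstar"
    using unique_nash_equilibrium[OF A1_smooth A1_lipschitz A2_pos A2] by blast
  have "\<exists>\<delta>star>0. \<forall>\<delta>>\<delta>star. \<exists>c>0. seeking_dissipates f a (\<lambda>i j. \<delta> * \<delta>bar i j) (\<lambda>i j. 1 / \<delta>bar i j) xstar c"
    by (rule seeking_dissipation[where l = l and m = m and E = E])
       (fact players A1_lipschitz A2_pos A2 A3_adjacency A3_undirected A3_connected \<delta>bar_pos zero)+
  then obtain \<delta>star where pos: "\<delta>star > 0" and diss: "\<forall>\<delta>>\<delta>star. \<exists>c>0.
      seeking_dissipates f a (\<lambda>i j. \<delta> * \<delta>bar i j) (\<lambda>i j. 1 / \<delta>bar i j) xstar c"
    by blast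
  show ?thesis
  proof (intro exI[of _ xstar] conjI nash unique exI[of _ \<delta>star] pos allI impI)
    fix \<delta> S0 assume "\<delta> > \<delta>star"
    then obtain c where c: "c > 0" "seeking_dissipates f a (\<lambda>i j. \<delta> * \<delta>bar i j) (\<lambda>i j. 1 / \<delta>bar i j) xstar c"
      using diss by blast
    interpret closed_loop f \<phi>1 \<phi>2 b1 b2 \<theta>1 \<theta>2 l a "\<lambda>i j. \<delta> * \<delta>bar i j" "\<lambda>i j. 1 / \<delta>bar i j" c xstar
    proof
      show "partial i (f i) xstar = 0" for i using zero by (simp add: pseudo_gradient_def vec_eq_iff)
      show "0 < 1 / \<delta>bar i j" for i j using \<delta>bar_pos by simp
    qed (fact b1_nonzero b2_nonzero \<phi>1_smooth \<phi>2_smooth A1_lipschitz c)+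
    show "\<exists>S. closed_loop_solution f a \<phi>1 \<phi>2 b1 b2 \<theta>1 \<theta>2 (\<lambda>i j. \<delta> * \<delta>bar i j) S \<and> S 0 = S0"
      unfolding closed_loop_solution_iff by (rule global_solution_exists)
    fix S
    assume "closed_loop_solution f a \<phi>1 \<phi>2 b1 b2 \<theta>1 \<theta>2 (\<lambda>i j. \<delta> * \<delta>bar i j) S \<and> S 0 = S0"
    then have S: "solves_on {0..} S" unfolding closed_loop_solution_iff by blast
    show "((\<lambda>t. norm (st_x (S t) - xstar)) \<longlongrightarrow> 0) at_top" by (rule x_tendsto[OF S])
    fix i
    note signal = bounded_signal_of_reachable[OF S]
    show "bounded_signal (\<lambda>t. st_v (S t) $ i)" by (rule signal[OF v_bounded])
    show "bounded_signal (\<lambda>t. st_y (S t) $ i)" by (rule signal[OF y_bounded])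
    show "bounded_signal (\<lambda>t. st_z (S t) $ i $ j)" for j
      by (rule signal[OF z_bounded])
    show "bounded_signal (\<lambda>t. st_k1 (S t) $ i)" by (rule signal[OF k1_bounded])
    show "bounded_signal (\<lambda>t. st_th1hat (S t) $ i)" by (rule signal[OF tracking_error_and_hat_estimate_bounded(2)])
    show "bounded_signal (\<lambda>t. st_k2 (S t) $ i)" by (rule signal[OF k2_bounded])
    show "bounded_signal (\<lambda>t. st_th1bar (S t) $ i)" by (rule signal[OF beta_and_bar_estimates_bounded(3)])
    show "bounded_signal (\<lambda>t. st_th2bar (S t) $ i)" by (rule signal[OF beta_and_bar_estimates_bounded(2)])
    show "bounded_signal (\<lambda>t. st_b1bar (S t) $ i)" by (rule signal[OF beta_and_bar_estimates_bounded(4)])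
  qed
qed

end
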